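(* Let $\Lambda$, $\gamma_i(n)$, $\xi_i,\eta_i$, the arrays $\mathrm B,\Theta,\mathrm E,\mathrm T$ and the generator $\mathbf R$ be as in the context. Fix $N\in\mathbb Z_+$ and set $$\Xi_{N,\Lambda}=\sum_{\substack{\underline y,\underline n\in\mathbb Z_+^\Lambda:\\ |\underline n|=N}}\ \prod_{l\in\Lambda}\left[\frac{\xi_l}{\eta_l}\overline\gamma_l(n_l)\right]^{y_l}.$$ If $\Xi_{N,\Lambda}<\infty$, then the continuous-time Markov process on $\{(\underline y,\underline n)\in\mathbb Z_+^\Lambda\times\mathbb Z_+^\Lambda:\ |\underline n|=N\}$ with generator $\mathbf R$ is positive recurrent and reversible. Its stationary probabilities are $$\pi(\underline y,\underline n)=\frac{\mathbf 1(|\underline n|=N)}{\Xi_{N,\Lambda}}\prod_{l\in\Lambda}\left[\frac{\xi_l}{\eta_l}\overline\gamma_l(n_l)\right]^{y_l}.$$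
   Context: $\Lambda$ is a finite set of sites and $\mathbb Z_+=\{0,1,2,\dots\}$. A state is $(\underline y,\underline n)$ with $\underline y=(y_s)_{s\in\Lambda}\in\mathbb Z_+^\Lambda$ (numbers of distinguished customers at the sites) and $\underline n=(n_i)_{i\in\Lambda}\in\mathbb Z_+^\Lambda$ (numbers of tasks). $|\underline n|=\sum_sn_s$; write $j\in\underline y$ if $y_j\ge1$ and $l\notin\underline y$ if $y_l=0$. $\underline e^i$ is the unit vector at $i$, $\underline e^{i\to k}=\underline e^k-\underline e^i$, and $\mathbf 1$ is the indicator. The values $\gamma_i(n)\ge0$, $i\in\Lambda$, $n\in\mathbb Z_+$, satisfy $\gamma_i(0)=1$ and $\gamma_i(n)>0$ whenever $\gamma_i(n+1)>0$. Set $\overline\gamma_i(0)=1$, $\overline\gamma_i(n)=\prod_{0\le m<n}\gamma_i(m)$ for $n\ge1$. It is understood that $\overline\gamma_j(n_j)>0$ wherever its reciprocal appears below. The numbers $\xi_k>0$, $\eta_k>0$, $k\in\Lambda$, do not depend on $\underline n,\underline y$. The collections $\mathrm B(\underline n;\underline y)=(\beta_{kl}(n_k,n_l;\underline y))$, $\Theta(\underline n;\underline y)=(\theta_{kl}(n_k,n_l;\underline y))$, $\mathrm E(\underline n;\underline y)=(\epsilon_{ij}(n_i,n_j;\underline y))$, $\mathrm T(\underline n;\underline y)=(\tau_{jj'}(\underline n;\underline y))$ are irreducible, meaning that their off-diagonal entries are strictly positive. They satisfy: $$\beta_{kl}(n_k,n_l;\underline y)=\beta_{lk}(n_l+1,n_k-1;\underline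 y),\quad k\ne l,\ k,l\notin\underline y,\ n_k\ge1;$$ $$\theta_{jk}(n_j,n_k;\underline y)=\theta_{kj}(n_k+1,n_j-1;\underline y),\quad j\in\underline y,\ k\notin\underline y,\ n_j\ge1;$$ $$\epsilon_{ij}(n_i,n_j;\underline y)[\gamma_i(n_i-1)]^{y_i}=[\gamma_j(n_j)]^{y_j}\epsilon_{ji}(n_j+1,n_i-1;\underline y),\quad i\ne j,\ i,j\in\underline y,\ n_i\ge1;$$ $$\tau_{jj'}(\underline n;\underline y)\frac{\xi_j}{\eta_j}=\tau_{j'j}(\underline n;\underline y+\underline e^{j\to j'})\frac{\xi_{j'}}{\eta_{j'}},\quad j\in\underline y,\ j'\ne j.$$ The generator $\mathbf R$ has the following off-diagonal entries (all others are zero): - $R[(\underline y,\underline n);(\underline y,\underline n+\underline e^{k\to l})]=\beta_{kl}(n_k,n_l;\underline y)\mathbf 1(n_k\ge1)$, $k\ne l$, $k,l\notin\underline y$; - $R[(\underline y,\underline n);(\underline y,\underline n+\underline e^{i\to j})]=\epsilon_{ij}(n_i,n_j;\underline y)\mathbf 1(n_i\ge1)$, $i\ne j$, $i,j\in\underline y$; - $R[(\underline y,\underline n);(\underline y,\underline n+\underline e^{j\to l})]=\theta_{jl}(n_j,n_l;\underline y)\mathbf 1(n_j\ge1)$, $j\in\underline y$, $l\notin\underline y$; - $R[(\underline y,\underline n);(\underline y,\underline n+\underline e^{k\to j})]=\theta_{kj}(n_k,n_j;\underline y)[\gamma_j(n_j)]^{y_j}\mathbf 1(n_k\ge1)$,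 $j\in\underline y$, $k\notin\underline y$; - $R[(\underline y,\underline n);(\underline y+\underline e^{j\to j'},\underline n)]=[\overline\gamma_j(n_j)]^{-y_j}\,\tau_{jj'}(\underline n;\underline y)\,[\overline\gamma_{j'}(n_{j'})]^{-y_{j'}}$, $j\in\underline y$, $j'\ne j$; - $R[(\underline y,\underline n);(\underline y+\underline e^p,\underline n)]=\xi_p\overline\gamma_p(n_p)$ and $R[(\underline y,\underline n);(\underline y-\underline e^p,\underline n)]=\eta_p\mathbf 1(y_p\ge1)$, $p\in\Lambda$. *)

theory Defs
  imports "HOL-Probability.Probability"
begin

section \<open>The continuous-time Markov process with a given generator\<close>

text \<open>
  Let \<open>Q\<close> be a conservative generator matrix on a countable type, \<open>- Q x x\<close> being the total rate
  out of \<open>x\<close>. The Markov process is the usual minimal right-continuous one: in state \<open>x\<close> it waits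
  for an exponential time of rate \<open>- Q x x\<close> and then jumps to \<open>y\<close> with probability
  \<open>Q x y / (- Q x x)\<close>, all of these choices being independent.

  At an absorbing state (\<open>Q x x = 0\<close>) the process makes fictitious jumps from \<open>x\<close> to \<open>x\<close> at rate 1.
  This does not alter the law of the process, and it makes an absorbing state positive recurrent
  below, which is the usual convention.
\<close>

definition hold_rate :: "('s \<Rightarrow> 's \<Rightarrow> real) \<Rightarrow> 's \<Rightarrow> real" where
  "hold_rate Q x = (if - Q x x > 0 then - Q x x else 1)"

definition jump_pmf :: "('s \<Rightarrow> 's \<Rightarrow> real) \<Rightarrow> 's \<Rightarrow> 's pmf" where
  "jump_pmf Q x =
     (if - Q x x > 0 then embed_pmf (\<lambda>y. if y = x then 0 else Q x y / (- Q x x))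
      else return_pmf x)"

text \<open>
  All the randomness is put on one probability space, which does not depend on the initial state.
  A sample point \<open>\<omega>\<close> is a sequence of independent identically distributed tables; the table
  \<open>\<omega> !! n\<close> lists, independently for every state \<open>x\<close>, the next state and the holding time to be used
  if the process is in \<open>x\<close> after \<open>n\<close> jumps.
\<close>

definition instruction_law :: "('s \<Rightarrow> 's \<Rightarrow> real) \<Rightarrow> 's \<Rightarrow> ('s \<times> real) measure" where
  "instruction_law Q x =
     measure_pmf (jump_pmf Q x) \<Otimes>\<^sub>M density lborel (exponential_density (hold_rate Q x))"

definition sample_space :: "('s \<Rightarrow> 's \<Rightarrow> real) \<Rightarrow> ('s \<Rightarrow> 's \<times> real) stream measure" where
  "sample_space Q = stream_space (PiM UNIV (instruction_law Q))"

primrec jump_chain :: "'s \<Rightarrow> ('s \<Rightarrow> 's \<times> real) stream \<Rightarrow> nat \<Rightarrow> 's" where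
  "jump_chain x \<omega> 0 = x"
| "jump_chain x \<omega> (Suc n) = fst ((\<omega> !! n) (jump_chain x \<omega> n))"

definition holding_time :: "'s \<Rightarrow> ('s \<Rightarrow> 's \<times> real) stream \<Rightarrow> nat \<Rightarrow> real" where
  "holding_time x \<omega> n = snd ((\<omega> !! n) (jump_chain x \<omega> n))"

definition jump_time :: "'s \<Rightarrow> ('s \<Rightarrow> 's \<times> real) stream \<Rightarrow> nat \<Rightarrow> real" where
  "jump_time x \<omega> n = (\<Sum>m<n. holding_time x \<omega> m)"

text \<open>
  The process started in \<open>x\<close>. The value \<open>None\<close> is taken from the explosion time on, if there are
  infinitely many jumps in finite time.
\<close>

definition process :: "'s \<Rightarrow> ('s \<Rightarrow> 's \<times> real) stream \<Rightarrow> real \<Rightarrow> 's option" where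
  "process x \<omega> t =
     (if \<exists>n. t < jump_time x \<omega> (Suc n)
      then Some (jump_chain x \<omega> (LEAST n. t < jump_time x \<omega> (Suc n)))
      else None)"

definition return_time :: "'s \<Rightarrow> ('s \<Rightarrow> 's \<times> real) stream \<Rightarrow> ennreal" where
  "return_time x \<omega> = Inf {ennreal t |t. jump_time x \<omega> 1 \<le> t \<and> process x \<omega> t = Some x}"

text \<open>
  Every state of \<open>E\<close> has a finite expected return time. In particular it is revisited almost
  surely, since the return time is infinite if the process never returns or explodes before that.
\<close>

definition positive_recurrent :: "'s set \<Rightarrow> ('s \<Rightarrow> 's \<Rightarrow> real) \<Rightarrow> bool" where
  "positive_recurrent E Q \<longleftrightarrow>
     (\<forall>x\<in>E. (\<integral>\<^sup>+ \<omega>. return_time x \<omega> \<partial>sample_space Q) < \<infinity>)"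

text \<open>
  Finite-dimensional distributions for the initial distribution \<open>\<mu>\<close> on \<open>E\<close>: for a finite set
  \<open>A = {(t\<^sub>1, z\<^sub>1), \<dots>, (t\<^sub>k, z\<^sub>k)}\<close>, the probability that the process is in \<open>z\<^sub>i\<close> at time \<open>t\<^sub>i\<close> for
  all \<open>i\<close>.
\<close>

definition fin_dim_prob ::
  "'s set \<Rightarrow> ('s \<Rightarrow> 's \<Rightarrow> real) \<Rightarrow> ('s \<Rightarrow> real) \<Rightarrow> (real \<times> 's) set \<Rightarrow> real" where
  "fin_dim_prob E Q \<mu> A =
     (\<Sum>\<^sub>\<infinity>x\<in>E. \<mu> x * measure (sample_space Q)
        {\<omega> \<in> space (sample_space Q). \<forall>(t, z)\<in>A. process x \<omega> t = Some z})"

definition prob_distribution :: "'s set \<Rightarrow> ('s \<Rightarrow> real) \<Rightarrow> bool" where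
  "prob_distribution E \<mu> \<longleftrightarrow> (\<forall>x\<in>E. 0 \<le> \<mu> x) \<and> (\<mu> has_sum 1) E"

definition stationary_distribution ::
  "'s set \<Rightarrow> ('s \<Rightarrow> 's \<Rightarrow> real) \<Rightarrow> ('s \<Rightarrow> real) \<Rightarrow> bool" where
  "stationary_distribution E Q \<mu> \<longleftrightarrow>
     prob_distribution E \<mu> \<and> (\<forall>t\<ge>0. \<forall>z\<in>E. fin_dim_prob E Q \<mu> {(t, z)} = \<mu> z)"

text \<open>
  Reversibility of the process with initial distribution \<open>\<mu>\<close>: for all times in \<open>[0, T]\<close>,
  \<open>(X\<^bsub>t\<^sub>1\<^esub>, \<dots>, X\<^bsub>t\<^sub>k\<^esub>)\<close> and \<open>(X\<^bsub>T - t\<^sub>1\<^esub>, \<dots>, X\<^bsub>T - t\<^sub>k\<^esub>)\<close> have the same law.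
\<close>

definition reversible :: "'s set \<Rightarrow> ('s \<Rightarrow> 's \<Rightarrow> real) \<Rightarrow> ('s \<Rightarrow> real) \<Rightarrow> bool" where
  "reversible E Q \<mu> \<longleftrightarrow>
     (\<forall>T\<ge>0. \<forall>A. finite A \<longrightarrow> A \<subseteq> {0..T} \<times> E \<longrightarrow>
        fin_dim_prob E Q \<mu> ((\<lambda>(t, z). (T - t, z)) ` A) = fin_dim_prob E Q \<mu> A)"

section \<open>The network\<close>

text \<open>
  The sites are the elements of a finite type. A state is a pair \<open>(y, n)\<close>, where \<open>y j\<close> is the number
  of distinguished customers and \<open>n i\<close> the number of tasks at a site.
\<close>

type_synonym 'a state = "('a \<Rightarrow> nat) \<times> ('a \<Rightarrow> nat)"

text \<open>\<open>v + e\<^sup>k - e\<^sup>i\<close>; only used for \<open>i \<noteq> k\<close> and \<open>v i \<ge> 1\<close>.\<close>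

definition move :: "'a \<Rightarrow> 'a \<Rightarrow> ('a \<Rightarrow> nat) \<Rightarrow> 'a \<Rightarrow> nat" where
  "move i k v = v(i := v i - 1, k := v k + 1)"

definition gamma_bar :: "('a \<Rightarrow> nat \<Rightarrow> real) \<Rightarrow> 'a \<Rightarrow> nat \<Rightarrow> real" where
  "gamma_bar \<gamma> i n = (\<Prod>m<n. \<gamma> i m)"

text \<open>
  The arguments \<open>\<beta>\<close>, \<open>\<theta>\<close>, \<open>\<epsilon>\<close> are the arrays \<open>\<beta> k l n\<^sub>k n\<^sub>l y\<close> etc. A task move from \<open>k\<close> to \<open>l\<close> has
  one of four rates, according to which of the two sites hold distinguished customers.
\<close>

definition task_rate ::
  "('a \<Rightarrow> nat \<Rightarrow> real) \<Rightarrow>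
   ('a \<Rightarrow> 'a \<Rightarrow> nat \<Rightarrow> nat \<Rightarrow> ('a \<Rightarrow> nat) \<Rightarrow> real) \<Rightarrow>
   ('a \<Rightarrow> 'a \<Rightarrow> nat \<Rightarrow> nat \<Rightarrow> ('a \<Rightarrow> nat) \<Rightarrow> real) \<Rightarrow>
   ('a \<Rightarrow> 'a \<Rightarrow> nat \<Rightarrow> nat \<Rightarrow> ('a \<Rightarrow> nat) \<Rightarrow> real) \<Rightarrow>
   ('a \<Rightarrow> nat) \<Rightarrow> ('a \<Rightarrow> nat) \<Rightarrow> 'a \<Rightarrow> 'a \<Rightarrow> real" where
  "task_rate \<gamma> \<beta> \<theta> \<epsilon> y n k l =
     (if y k = 0 \<and> y l = 0 then \<beta> k l (n k) (n l) y
      else if y k \<ge> 1 \<and> y l \<ge> 1 then \<epsilon> k l (n k) (n l) y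
      else if y k \<ge> 1 then \<theta> k l (n k) (n l) y
      else \<theta> k l (n k) (n l) y * \<gamma> l (n l) ^ y l)"

definition customer_rate ::
  "('a \<Rightarrow> nat \<Rightarrow> real) \<Rightarrow>
   ('a \<Rightarrow> 'a \<Rightarrow> ('a \<Rightarrow> nat) \<Rightarrow> ('a \<Rightarrow> nat) \<Rightarrow> real) \<Rightarrow>
   ('a \<Rightarrow> nat) \<Rightarrow> ('a \<Rightarrow> nat) \<Rightarrow> 'a \<Rightarrow> 'a \<Rightarrow> real" where
  "customer_rate \<gamma> \<tau> y n j j' =
     inverse (gamma_bar \<gamma> j (n j) ^ y j) * \<tau> j j' n y * inverse (gamma_bar \<gamma> j' (n j') ^ y j')"

text \<open>
  Entries of the generator from \<open>(y, n)\<close> to another state \<open>(y', n')\<close>. The transitions out of a state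
  have pairwise different targets, so at most one of all the summands below is present.
\<close>

definition network_rate ::
  "('a::finite \<Rightarrow> nat \<Rightarrow> real) \<Rightarrow> ('a \<Rightarrow> real) \<Rightarrow> ('a \<Rightarrow> real) \<Rightarrow>
   ('a \<Rightarrow> 'a \<Rightarrow> nat \<Rightarrow> nat \<Rightarrow> ('a \<Rightarrow> nat) \<Rightarrow> real) \<Rightarrow>
   ('a \<Rightarrow> 'a \<Rightarrow> nat \<Rightarrow> nat \<Rightarrow> ('a \<Rightarrow> nat) \<Rightarrow> real) \<Rightarrow>
   ('a \<Rightarrow> 'a \<Rightarrow> nat \<Rightarrow> nat \<Rightarrow> ('a \<Rightarrow> nat) \<Rightarrow> real) \<Rightarrow>
   ('a \<Rightarrow> 'a \<Rightarrow> ('a \<Rightarrow> nat) \<Rightarrow> ('a \<Rightarrow> nat) \<Rightarrow> real) \<Rightarrow>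
   'a state \<Rightarrow> 'a state \<Rightarrow> real" where
  "network_rate \<gamma> \<xi> \<eta> \<beta> \<theta> \<epsilon> \<tau> = (\<lambda>(y, n) (y', n').
     (\<Sum>(k, l) \<in> {(k, l). k \<noteq> l \<and> n k \<ge> 1 \<and> y' = y \<and> n' = move k l n}.
        task_rate \<gamma> \<beta> \<theta> \<epsilon> y n k l)
   + (\<Sum>(j, j') \<in> {(j, j'). j \<noteq> j' \<and> y j \<ge> 1 \<and> y' = move j j' y \<and> n' = n}.
        customer_rate \<gamma> \<tau> y n j j')
   + (\<Sum>p \<in> {p. y' = y(p := y p + 1) \<and> n' = n}. \<xi> p * gamma_bar \<gamma> p (n p))
   + (\<Sum>p \<in> {p. y p \<ge> 1 \<and> y' = y(p := y p - 1) \<and> n' = n}. \<eta> p))"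

text \<open>The infinite sum has only finitely many non-zero terms.\<close>

definition network_generator ::
  "('a::finite \<Rightarrow> nat \<Rightarrow> real) \<Rightarrow> ('a \<Rightarrow> real) \<Rightarrow> ('a \<Rightarrow> real) \<Rightarrow>
   ('a \<Rightarrow> 'a \<Rightarrow> nat \<Rightarrow> nat \<Rightarrow> ('a \<Rightarrow> nat) \<Rightarrow> real) \<Rightarrow>
   ('a \<Rightarrow> 'a \<Rightarrow> nat \<Rightarrow> nat \<Rightarrow> ('a \<Rightarrow> nat) \<Rightarrow> real) \<Rightarrow>
   ('a \<Rightarrow> 'a \<Rightarrow> nat \<Rightarrow> nat \<Rightarrow> ('a \<Rightarrow> nat) \<Rightarrow> real) \<Rightarrow>
   ('a \<Rightarrow> 'a \<Rightarrow> ('a \<Rightarrow> nat) \<Rightarrow> ('a \<Rightarrow> nat) \<Rightarrow> real) \<Rightarrow>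
   'a state \<Rightarrow> 'a state \<Rightarrow> real" where
  "network_generator \<gamma> \<xi> \<eta> \<beta> \<theta> \<epsilon> \<tau> x x' =
     (if x' = x then - (\<Sum>\<^sub>\<infinity>z\<in>UNIV - {x}. network_rate \<gamma> \<xi> \<eta> \<beta> \<theta> \<epsilon> \<tau> x z)
      else network_rate \<gamma> \<xi> \<eta> \<beta> \<theta> \<epsilon> \<tau> x x')"

definition states :: "nat \<Rightarrow> 'a::finite state set" where
  "states N = {(y, n). (\<Sum>s\<in>UNIV. n s) = N}"

definition weight ::
  "('a::finite \<Rightarrow> nat \<Rightarrow> real) \<Rightarrow> ('a \<Rightarrow> real) \<Rightarrow> ('a \<Rightarrow> real) \<Rightarrow> 'a state \<Rightarrow> real" where
  "weight \<gamma> \<xi> \<eta> = (\<lambda>(y, n). \<Prod>l\<in>UNIV. (\<xi> l / \<eta> l * gamma_bar \<gamma> l (n l)) ^ y l)"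

definition partition_sum ::
  "('a::finite \<Rightarrow> nat \<Rightarrow> real) \<Rightarrow> ('a \<Rightarrow> real) \<Rightarrow> ('a \<Rightarrow> real) \<Rightarrow> nat \<Rightarrow> ennreal" where
  "partition_sum \<gamma> \<xi> \<eta> N = (\<Sum>\<^sub>\<infinity>x\<in>states N. ennreal (weight \<gamma> \<xi> \<eta> x))"

definition equilibrium ::
  "('a::finite \<Rightarrow> nat \<Rightarrow> real) \<Rightarrow> ('a \<Rightarrow> real) \<Rightarrow> ('a \<Rightarrow> real) \<Rightarrow> nat \<Rightarrow> 'a state \<Rightarrow> real" where
  "equilibrium \<gamma> \<xi> \<eta> N x =
     indicator (states N) x / enn2real (partition_sum \<gamma> \<xi> \<eta> N) * weight \<gamma> \<xi> \<eta> x"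

end

theory Submission
  imports Defs
begin

text \<open>
  Detailed balance is an algebraic identity for the weights, so everything hinges on the process.
  By the lack of memory of the holding times, the process is Markov, and its transition
  probabilities with exactly \<open>n\<close> jumps satisfy both a first-jump and a last-jump recursion;
  detailed balance exchanges the two, whence the transition probabilities are symmetric with
  respect to the weights. There is no explosion, although the rates may be unbounded: the number of
  distinguished customers changes at a bounded rate, and between two changes only finitely many
  states are available. Symmetry and non-explosion give stationarity and reversibility.

  For positive recurrence, the expected length of an excursion from \<open>x\<close> is a sum over paths of the
  jump chain avoiding \<open>x\<close>; reversing these paths turns it into a sum, over the states \<open>z\<close>, of the
  weight of \<open>z\<close> times the probability of ever hitting \<open>x\<close> from \<open>z\<close>. Uniqueness of the
  stationary distribution follows since all transition probabilities are positive.
\<close>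

section \<open>The Markov property\<close>

text \<open>Nothing bounds \<open>\<beta>\<close>, \<open>\<theta>\<close>,
  \<open>\<epsilon>\<close>, \<open>\<tau>\<close> as functions of \<open>y\<close>, so the exit
  rate \<open>q\<close> may be unbounded and the weights \<open>W z * q z\<close>, which are
  invariant for the jump chain, need not be summable. Hence positive recurrence cannot be read off
  from an invariant law of the jump chain; in the excursion sums each \<open>q z\<close> is
  cancelled by the mean holding time \<open>1 / q z\<close>, and only the summable
  \<open>W z\<close> remains. The rate of change of the number of customers is bounded because
  arrival rates depend on \<open>n p\<close> alone, which is at most \<open>N\<close>, and departure
  rates are constant. The two recursions are the backward and forward integral equations, taken one
  jump at a time. Counting jumps makes them true by induction, with no uniqueness theorem for the
  equations and no prior control of explosion; nonnegative extended values make every exchange of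
  integrals an instance of Tonelli.\<close>

lemma borel_measurable_count_space_pair:
  fixes f :: "'i::countable \<times> 'b \<Rightarrow> 'c"
  assumes "\<And>i. (\<lambda>x. f (i, x)) \<in> measurable M N"
  shows "f \<in> measurable (count_space UNIV \<Otimes>\<^sub>M M) N"
proof -
  have "(\<lambda>z. f (fst z, snd z)) \<in> measurable (count_space UNIV \<Otimes>\<^sub>M M) N"
    by (rule measurable_compose_countable[where f="\<lambda>i z. f (i, snd z)"])
       (auto intro: measurable_compose[OF measurable_snd assms])
  then show ?thesis by simp
qed

lemma nn_integral_count_space_single:
  "(\<integral>\<^sup>+y. (if y = z then f y else 0) \<partial>count_space UNIV) = (f z :: ennreal)"
  by (subst nn_integral_count_space'[of "{z}"]) auto

lemma exponential_density_shift:
  assumes "0 \<le> u" "0 < s"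
  shows "exponential_density l (s + u) = exp (- l * u) * exponential_density l s"
  using assms by (simp add: exponential_density_def exp_add[symmetric] algebra_simps)

locale jump_process =
  fixes Q :: "'s::countable \<Rightarrow> 's \<Rightarrow> real"
begin

abbreviation p :: "'s \<Rightarrow> 's pmf" where "p \<equiv> jump_pmf Q"
abbreviation q :: "'s \<Rightarrow> real" where "q \<equiv> hold_rate Q"
abbreviation tables :: "('s \<Rightarrow> 's \<times> real) measure" where "tables \<equiv> PiM UNIV (instruction_law Q)"
abbreviation Om :: "('s \<Rightarrow> 's \<times> real) stream measure" where "Om \<equiv> sample_space Q"

section \<open>Measurability and first-step analysis on the sample space\<close>

lemma q_pos [simp]: "0 < q x"
  by (simp add: hold_rate_def)

lemma q_nonneg [simp]: "0 \<le> q x"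
  using q_pos[of x] by linarith

lemma sets_instruction_law [measurable_cong]:
  "sets (instruction_law Q x) = sets (count_space UNIV \<Otimes>\<^sub>M borel)"
  by (auto simp: instruction_law_def intro!: sets_pair_measure_cong)

lemma prob_space_instruction_law: "prob_space (instruction_law Q x)"
proof -
  interpret A: prob_space "measure_pmf (p x)" by (rule prob_space_measure_pmf)
  interpret B: prob_space "density lborel (exponential_density (q x))"
    by (rule prob_space_exponential_density) simp
  interpret pair_prob_space "measure_pmf (p x)" "density lborel (exponential_density (q x))" ..
  show ?thesis unfolding instruction_law_def by unfold_locales
qed

lemma prob_space_tables: "prob_space tables"
  by (intro prob_space_PiM prob_space_instruction_law)

lemma prob_space_Om: "prob_space Om"
  unfolding sample_space_def by (rule prob_space.prob_space_stream_space[OF prob_space_tables])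

sublocale tables: prob_space tables by (rule prob_space_tables)
sublocale Om: prob_space Om by (rule prob_space_Om)

lemma space_tables [simp]: "space tables = UNIV"
  by (auto simp: space_PiM sets_eq_imp_space_eq[OF sets_instruction_law] space_pair_measure PiE_def extensional_def)

lemma space_Om [simp]: "space Om = UNIV"
  by (simp add: sample_space_def space_stream_space)

lemma measurable_fst_table [measurable]: "(\<lambda>a. fst (a x)) \<in> measurable tables (count_space UNIV)"
  and measurable_snd_table [measurable]: "(\<lambda>a. snd (a x)) \<in> borel_measurable tables"
proof -
  have "(\<lambda>a. a x) \<in> measurable tables (instruction_law Q x)" by simp
  then have [measurable]: "(\<lambda>a. a x) \<in> measurable tables (count_space UNIV \<Otimes>\<^sub>M borel)"
    by (subst (asm) measurable_cong_sets[OF refl sets_instruction_law])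
  show "(\<lambda>a. fst (a x)) \<in> measurable tables (count_space UNIV)"
    by (rule measurable_compose[OF _ measurable_fst]) fact
  show "(\<lambda>a. snd (a x)) \<in> borel_measurable tables"
    by (rule measurable_compose[OF _ measurable_snd]) fact
qed

lemma measurable_snth_Om: "(\<lambda>\<omega>. \<omega> !! n) \<in> measurable Om tables"
  unfolding sample_space_def by simp

lemma measurable_Stream_Om [measurable]:
  "(\<lambda>(a, \<omega>). a ## \<omega>) \<in> measurable (tables \<Otimes>\<^sub>M Om) Om"
  unfolding sample_space_def by measurable

lemma measurable_Stream_Om1 [measurable]: "(\<lambda>\<omega>. a ## \<omega>) \<in> measurable Om Om"
  using measurable_compose[OF _ measurable_Stream_Om, of "\<lambda>\<omega>. (a, \<omega>)" Om] by simp

lemma measurable_jump_chain [measurable]: "(\<lambda>\<omega>. jump_chain x \<omega> n) \<in> measurable Om (count_space UNIV)"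
proof (induction n)
  case (Suc n)
  show ?case
    unfolding jump_chain.simps
    by (rule measurable_compose_countable[where f="\<lambda>i \<omega>. fst ((\<omega> !! n) i)", OF _ Suc])
       (rule measurable_compose[OF measurable_snth_Om measurable_fst_table])
qed simp

lemma measurable_holding_time [measurable]: "(\<lambda>\<omega>. holding_time x \<omega> n) \<in> borel_measurable Om"
  unfolding holding_time_def
  by (rule measurable_compose_countable[where f="\<lambda>i \<omega>. snd ((\<omega> !! n) i)", OF _ measurable_jump_chain])
     (rule measurable_compose[OF measurable_snth_Om measurable_snd_table])

lemma measurable_jump_time [measurable]: "(\<lambda>\<omega>. jump_time x \<omega> n) \<in> borel_measurable Om"
  unfolding jump_time_def by measurable

text \<open>Fubini on the stream space: the tail is independent of the first table and has law
  \<open>Om\<close> again. Every conditioning on the first jump goes through this identity.\<close>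

lemma nn_integral_first_step:
  assumes "f \<in> borel_measurable Om"
  shows "(\<integral>\<^sup>+\<omega>. f \<omega> \<partial>Om) = (\<integral>\<^sup>+a. (\<integral>\<^sup>+\<omega>. f (a ## \<omega>) \<partial>Om) \<partial>tables)"
  using tables.nn_integral_stream_space assms unfolding sample_space_def by blast

text \<open>Only the entry at \<open>x\<close> is read, so the product measure projects to that
  coordinate, where target and holding time are independent.\<close>

lemma nn_integral_table:
  assumes [measurable]: "g \<in> borel_measurable (count_space UNIV \<Otimes>\<^sub>M borel)"
  shows "(\<integral>\<^sup>+a. g (a x) \<partial>tables) =
    (\<integral>\<^sup>+y. (\<integral>\<^sup>+s. ennreal (exponential_density (q x) s) * g (y, s) \<partial>lborel) \<partial>p x)"
proof -
  interpret B: prob_space "density lborel (exponential_density (q x))"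
    by (rule prob_space_exponential_density) simp
  have m: "g \<in> borel_measurable (measure_pmf (p x) \<Otimes>\<^sub>M density lborel (exponential_density (q x)))"
    by (subst measurable_cong_sets[OF sets_pair_measure_cong refl, of _ "count_space UNIV" _ borel]) (auto simp: assms)
  have gy [measurable]: "(\<lambda>s. g (y, s)) \<in> borel_measurable borel" for y
    by measurable
  have "(\<integral>\<^sup>+a. g (a x) \<partial>tables) = (\<integral>\<^sup>+z. g z \<partial>distr tables (instruction_law Q x) (\<lambda>a. a x))"
    by (rule nn_integral_distr[symmetric])
       (simp, subst measurable_cong_sets[OF sets_distr refl], subst measurable_cong_sets[OF sets_instruction_law refl], rule assms)
  also have "\<dots> = (\<integral>\<^sup>+z. g z \<partial>instruction_law Q x)"
    by (subst distr_PiM_component) (auto intro: prob_space_instruction_law)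
  also have "\<dots> = (\<integral>\<^sup>+y. (\<integral>\<^sup>+s. g (y, s) \<partial>density lborel (exponential_density (q x))) \<partial>p x)"
    unfolding instruction_law_def by (rule B.nn_integral_fst[symmetric, OF m])
  also have "\<dots> = (\<integral>\<^sup>+y. (\<integral>\<^sup>+s. ennreal (exponential_density (q x) s) * g (y, s) \<partial>lborel) \<partial>p x)"
    by (intro nn_integral_cong nn_integral_density) auto
  finally show ?thesis .
qed

declare jump_chain.simps(2) [simp del]

text \<open>The defining recursion appends the last jump, whereas the proofs cut off the first
  table; this rule takes its place in the simpset.\<close>

lemma jump_chain_Stream [simp]: "jump_chain x (a ## \<omega>) (Suc n) = jump_chain (fst (a x)) \<omega> n"
  by (induction n) (simp_all add: jump_chain.simps(2))

lemma holding_time_Stream [simp]: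
  "holding_time x (a ## \<omega>) 0 = snd (a x)"
  "holding_time x (a ## \<omega>) (Suc n) = holding_time (fst (a x)) \<omega> n"
  by (simp_all add: holding_time_def)

lemma jump_time_Stream [simp]:
  "jump_time x (a ## \<omega>) (Suc n) = snd (a x) + jump_time (fst (a x)) \<omega> n"
  unfolding jump_time_def sum.lessThan_Suc_shift by simp

lemma jump_time_0 [simp]: "jump_time x \<omega> 0 = 0"
  by (simp add: jump_time_def)

text \<open>Refines \<open>process x \<omega> t = Some z\<close> by the number of jumps up to
  \<open>t\<close>, on which the inductions run. All earlier jump times are constrained, because
  holding times are positive only almost surely and jump times need not increase at every sample
  point.\<close>

definition visit :: "'s \<Rightarrow> ('s \<Rightarrow> 's \<times> real) stream \<Rightarrow> real \<Rightarrow> nat \<Rightarrow> 's \<Rightarrow> bool" where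
  "visit x \<omega> t n z \<longleftrightarrow>
     (\<forall>m<n. jump_time x \<omega> (Suc m) \<le> t) \<and> t < jump_time x \<omega> (Suc n) \<and> jump_chain x \<omega> n = z"

lemma visit_Stream:
  "visit x (a ## \<omega>) t 0 z \<longleftrightarrow> t < snd (a x) \<and> x = z"
  "visit x (a ## \<omega>) t (Suc n) z \<longleftrightarrow> snd (a x) \<le> t \<and> visit (fst (a x)) \<omega> (t - snd (a x)) n z"
  by (auto simp: visit_def All_less_Suc2 algebra_simps)

lemma process_eq_Some_iff: "process x \<omega> t = Some z \<longleftrightarrow> (\<exists>n. visit x \<omega> t n z)"
proof
  assume *: "process x \<omega> t = Some z"
  then have ex: "\<exists>n. t < jump_time x \<omega> (Suc n)" by (auto simp: process_def split: if_splits)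
  let ?n = "LEAST n. t < jump_time x \<omega> (Suc n)"
  have "visit x \<omega> t ?n z"
    unfolding visit_def using * ex LeastI_ex[OF ex]
    by (auto simp: process_def dest: not_less_Least intro!: leI)
  then show "\<exists>n. visit x \<omega> t n z" ..
next
  assume "\<exists>n. visit x \<omega> t n z"
  then obtain n where n: "visit x \<omega> t n z" ..
  then have "(LEAST n. t < jump_time x \<omega> (Suc n)) = n"
    by (intro Least_equality) (auto simp: visit_def intro: leI dest: leD)
  then show "process x \<omega> t = Some z" using n by (auto simp: process_def visit_def)
qed

lemma visit_unique: "visit x \<omega> t n z \<Longrightarrow> visit x \<omega> t n' z' \<Longrightarrow> n = n' \<and> z = z'"
  unfolding visit_def by (metis less_linear not_less)

lemma process_eq_None_iff: "process x \<omega> t = None \<longleftrightarrow> (\<forall>n. jump_time x \<omega> (Suc n) \<le> t)"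
  by (auto simp: process_def intro: leI dest: leD)

text \<open>Restarting at the first jump is an identity at every sample point, whatever the signs of
  \<open>t\<close> and of the holding time, so the inductions carry no exceptional null
  sets.\<close>

lemma process_Stream:
  fixes x :: 's
  shows
  "process x (a ## \<omega>) t = (if t < snd (a x) then Some x else process (fst (a x)) \<omega> (t - snd (a x)))"
proof -
  have "process x (a ## \<omega>) t = Some z \<longleftrightarrow>
      (if t < snd (a x) then Some x else process (fst (a x)) \<omega> (t - snd (a x))) = Some z" for z
  proof -
    have "process x (a ## \<omega>) t = Some z \<longleftrightarrow> visit x (a ## \<omega>) t 0 z \<or> (\<exists>n. visit x (a ## \<omega>) t (Suc n) z)"
      unfolding process_eq_Some_iff by (metis not0_implies_Suc)
    also have "\<dots> \<longleftrightarrow> (if t < snd (a x) then Some x else process (fst (a x)) \<omega> (t - snd (a x))) = Some z"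
      by (auto simp: visit_Stream process_eq_Some_iff)
    finally show ?thesis .
  qed
  then show ?thesis by (metis not_None_eq)
qed

lemma measurable_visit [measurable (raw)]:
  assumes [measurable]: "f \<in> measurable N Om" "g \<in> borel_measurable N"
  shows "Measurable.pred N (\<lambda>x. visit s (f x) (g x) n z)"
proof -
  have [measurable]: "(\<lambda>x. jump_time s (f x) m) \<in> borel_measurable N" for m
    by (rule measurable_compose[OF assms(1) measurable_jump_time])
  have [measurable]: "(\<lambda>x. jump_chain s (f x) m) \<in> measurable N (count_space UNIV)" for m
    by (rule measurable_compose[OF assms(1) measurable_jump_chain])
  show ?thesis unfolding visit_def by measurable
qed

lemma measurable_process [measurable (raw)]:
  fixes s z :: 's
  assumes [measurable]: "f \<in> measurable N Om" "g \<in> borel_measurable N"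
  shows "Measurable.pred N (\<lambda>x. process s (f x) (g x) = Some z)"
  unfolding process_eq_Some_iff by measurable


lemma emeasure_first_step:
  assumes [measurable]: "Measurable.pred Om P"
  shows "emeasure Om {\<omega>. P \<omega>} = (\<integral>\<^sup>+a. emeasure Om {\<omega>. P (a ## \<omega>)} \<partial>tables)"
proof -
  have "emeasure Om {\<omega>. P \<omega>} = (\<integral>\<^sup>+\<omega>. indicator {\<omega>. P \<omega>} \<omega> \<partial>Om)"
    using assms by (subst nn_integral_indicator) (auto simp: pred_def)
  also have "\<dots> = (\<integral>\<^sup>+a. \<integral>\<^sup>+\<omega>. indicator {\<omega>. P \<omega>} (a ## \<omega>) \<partial>Om \<partial>tables)"
    by (intro nn_integral_first_step) (use assms in \<open>auto simp: pred_def\<close>)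
  also have "\<dots> = (\<integral>\<^sup>+a. emeasure Om {\<omega>. P (a ## \<omega>)} \<partial>tables)"
  proof (rule nn_integral_cong)
    fix a
    have "Measurable.pred Om (\<lambda>\<omega>. P (a ## \<omega>))" by measurable
    then have "(\<integral>\<^sup>+\<omega>. indicator {\<omega>. P (a ## \<omega>)} \<omega> \<partial>Om) = emeasure Om {\<omega>. P (a ## \<omega>)}"
      by (intro nn_integral_indicator) (simp add: pred_def)
    then show "(\<integral>\<^sup>+\<omega>. indicator {\<omega>. P \<omega>} (a ## \<omega>) \<partial>Om) = emeasure Om {\<omega>. P (a ## \<omega>)}"
      by (simp add: indicator_def)
  qed
  finally show ?thesis .
qed

lemma borel_measurable_emeasure_pred:
  assumes "Measurable.pred (N \<Otimes>\<^sub>M Om) (\<lambda>(s, \<omega>). P s \<omega>)"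
  shows "(\<lambda>s. emeasure Om {\<omega>. P s \<omega>}) \<in> borel_measurable N"
proof -
  have "(\<lambda>s. emeasure Om (Pair s -` {z \<in> space (N \<Otimes>\<^sub>M Om). case z of (s, \<omega>) \<Rightarrow> P s \<omega>})) \<in> borel_measurable N"
    using assms by (intro Om.measurable_emeasure_Pair) (simp add: pred_def)
  also have "?this \<longleftrightarrow> ?thesis"
    by (intro measurable_cong arg_cong2[where f=emeasure]) (auto simp: space_pair_measure)
  finally show ?thesis .
qed

lemma borel_measurable_emeasure_Stream:
  assumes "Measurable.pred Om P"
  shows "(\<lambda>a. emeasure Om {\<omega>. P (a ## \<omega>)}) \<in> borel_measurable tables"
proof (rule borel_measurable_emeasure_pred)
  have "(\<lambda>z. P ((\<lambda>(a, \<omega>). a ## \<omega>) z)) \<in> measurable (tables \<Otimes>\<^sub>M Om) (count_space UNIV)"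
    by (rule measurable_compose[OF measurable_Stream_Om assms])
  then show "Measurable.pred (tables \<Otimes>\<^sub>M Om) (\<lambda>(a, \<omega>). P (a ## \<omega>))"
    by (simp add: case_prod_beta)
qed

text \<open>Target and holding time are independent, so given a holding time beyond
  \<open>u\<close>, target and overshoot together keep their original joint law. This is why
  \<open>g\<close> may depend on both.\<close>

lemma memoryless:
  assumes [measurable]: "g \<in> borel_measurable (count_space UNIV \<Otimes>\<^sub>M borel)" and u: "0 \<le> u"
  shows "(\<integral>\<^sup>+a. indicator {u<..} (snd (a x)) * g (fst (a x), snd (a x) - u) \<partial>tables) =
    ennreal (exp (- q x * u)) * (\<integral>\<^sup>+a. g (a x) \<partial>tables)"
proof -
  have [measurable]: "(\<lambda>s. g (y, s)) \<in> borel_measurable borel" for y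
    by measurable
  let ?e = "\<lambda>s. ennreal (exponential_density (q x) s)"
  have e: "(\<integral>\<^sup>+s. ?e s * (indicator {u<..} s * g (y, s - u)) \<partial>lborel) =
      ennreal (exp (- q x * u)) * (\<integral>\<^sup>+s. ?e s * g (y, s) \<partial>lborel)" for y
  proof -
    have "(\<integral>\<^sup>+s. ?e s * (indicator {u<..} s * g (y, s - u)) \<partial>lborel) =
        (\<integral>\<^sup>+s. ?e (s + u) * (indicator {u<..} (s + u) * g (y, s)) \<partial>lborel)"
      by (subst nn_integral_real_affine[where c=1 and t=u]) (auto simp: algebra_simps)
    also have "\<dots> = (\<integral>\<^sup>+s. ennreal (exp (- q x * u)) * (?e s * g (y, s)) \<partial>lborel)"
    proof (rule nn_integral_cong_AE)
      show "AE s in lborel. ?e (s + u) * (indicator {u<..} (s + u) * g (y, s)) =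
          ennreal (exp (- q x * u)) * (?e s * g (y, s))"
        \<comment> \<open>At \<open>s = 0\<close> the sides can differ: the strict indicator
          vanishes, the density does not.\<close>
        using AE_lborel_singleton[of 0]
      proof eventually_elim
        fix s :: real assume "s \<noteq> 0"
        then consider "s < 0" | "0 < s" by linarith
        then show "?e (s + u) * (indicator {u<..} (s + u) * g (y, s)) =
            ennreal (exp (- q x * u)) * (?e s * g (y, s))"
        proof cases
          case 1 then show ?thesis by (simp add: exponential_density_def)
        next
          case 2
          then show ?thesis
            using exponential_density_shift[OF u 2, of "q x"]
            by (simp add: ennreal_mult exponential_density_nonneg mult.assoc)
        qed
      qed
    qed
    also have "\<dots> = ennreal (exp (- q x * u)) * (\<integral>\<^sup>+s. ?e s * g (y, s) \<partial>lborel)"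
      by (intro nn_integral_cmult) measurable
    finally show ?thesis .
  qed
  have "(\<integral>\<^sup>+a. indicator {u<..} (snd (a x)) * g (fst (a x), snd (a x) - u) \<partial>tables) =
     (\<integral>\<^sup>+a. (\<lambda>(y, s). indicator {u<..} s * g (y, s - u)) (a x) \<partial>tables)"
    by (simp add: case_prod_beta)
  also have "\<dots> = (\<integral>\<^sup>+y. (\<integral>\<^sup>+s. ?e s * (indicator {u<..} s * g (y, s - u)) \<partial>lborel) \<partial>p x)"
    by (subst nn_integral_table) auto
  also have "\<dots> = (\<integral>\<^sup>+y. ennreal (exp (- q x * u)) * (\<integral>\<^sup>+s. ?e s * g (y, s) \<partial>lborel) \<partial>p x)"
    by (simp only: e)
  also have "\<dots> = ennreal (exp (- q x * u)) * (\<integral>\<^sup>+a. g (a x) \<partial>tables)"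
    by (subst nn_integral_table) (auto intro: nn_integral_cmult)
  finally show ?thesis .
qed

lemma emeasure_table_gt:
  assumes "0 \<le> u"
  shows "(\<integral>\<^sup>+a. indicator {u<..} (snd (a x)) \<partial>tables) = ennreal (exp (- q x * u))"
  using memoryless[of "\<lambda>_. 1" u x] assms by (simp add: tables.emeasure_space_1[simplified])

lemma pred_process_all [measurable]:
  assumes "finite A"
  shows "Measurable.pred Om (\<lambda>\<omega>. \<forall>(t, z)\<in>A. process (x::'s) \<omega> t = Some z)"
  using assms by (intro pred_intros_finite) (auto simp: case_prod_beta)

text \<open>
  The Markov property at time \<open>u\<close>, by induction on the number \<open>n\<close> of jumps up to \<open>u\<close>: conditioning
  on the first jump reduces \<open>n\<close>, and for \<open>n = 0\<close> the exponential holding time has no memory.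
\<close>

lemma markov_visit:
  assumes "finite A" "\<forall>(t, z)\<in>A. t \<le> u" "0 \<le> u" and v: "0 \<le> v"
  shows "emeasure Om {\<omega>. (\<forall>(t, z)\<in>A. process x \<omega> t = Some z) \<and> visit x \<omega> u n w \<and> process x \<omega> (u + v) = Some w'} =
    emeasure Om {\<omega>. (\<forall>(t, z)\<in>A. process x \<omega> t = Some z) \<and> visit x \<omega> u n w} *
    emeasure Om {\<omega>. process w \<omega> v = Some w'}"
  using assms(1-3)
proof (induction n arbitrary: x A u)
  case 0
  define ok where "ok \<longleftrightarrow> x = w \<and> (\<forall>(t, z)\<in>A. z = x)"
  \<comment> \<open>\<open>g (y, s)\<close> is the conditional probability of being in
    \<open>w'\<close> at time \<open>v\<close> when the first jump goes to \<open>y\<close> at time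
    \<open>s\<close>. If there is no jump up to \<open>u\<close>, the overshoot plays the role of
    \<open>s\<close>.\<close>
  define g where "g = (\<lambda>(y, s). if v < s then indicator {w'} x
                        else emeasure Om {\<omega>. process y \<omega> (v - s) = Some w'})"
  have g: "g \<in> borel_measurable (count_space UNIV \<Otimes>\<^sub>M borel)"
  proof (rule borel_measurable_count_space_pair)
    fix y
    have [measurable]: "(\<lambda>s. emeasure Om {\<omega>. process y \<omega> (v - s) = Some w'}) \<in> borel_measurable borel"
      by (rule borel_measurable_emeasure_pred) measurable
    show "(\<lambda>s. g (y, s)) \<in> borel_measurable borel"
      unfolding g_def by simp
  qed
  note [measurable] = pred_process_all[OF \<open>finite A\<close>]
  have all: "(\<forall>(t, z)\<in>A. process x (a ## \<omega>) t = Some z) \<and> visit x (a ## \<omega>) u 0 w \<longleftrightarrow>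
      u < snd (a x) \<and> ok" for a \<omega>
    using 0 unfolding visit_Stream ok_def by (fastforce simp: process_Stream)
  have top: "emeasure Om UNIV = 1" using Om.emeasure_space_1 by simp
  have 1: "emeasure Om {\<omega>. (\<forall>(t, z)\<in>A. process x \<omega> t = Some z) \<and> visit x \<omega> u 0 w} =
      (\<integral>\<^sup>+a. indicator {u<..} (snd (a x)) * (if ok then 1 else 0) \<partial>tables)"
    by (subst emeasure_first_step, measurable, rule nn_integral_cong)
       (simp add: all top indicator_def)
  have 2: "emeasure Om {\<omega>. process x \<omega> v = Some w'} = (\<integral>\<^sup>+a. g (a x) \<partial>tables)"
    by (subst emeasure_first_step, measurable, rule nn_integral_cong)
       (simp add: process_Stream g_def case_prod_beta top indicator_def)
  have "emeasure Om {\<omega>. (\<forall>(t, z)\<in>A. process x \<omega> t = Some z) \<and> visit x \<omega> u 0 w \<and> process x \<omega> (u + v) = Some w'} =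
      (\<integral>\<^sup>+a. (if ok then 1 else 0) * (indicator {u<..} (snd (a x)) * g (fst (a x), snd (a x) - u)) \<partial>tables)"
  proof (subst emeasure_first_step, measurable, rule nn_integral_cong)
    fix a
    have eq: "{\<omega>. (\<forall>(t, z)\<in>A. process x (a ## \<omega>) t = Some z) \<and> visit x (a ## \<omega>) u 0 w \<and>
                process x (a ## \<omega>) (u + v) = Some w'} =
        {\<omega>. (u < snd (a x) \<and> ok) \<and> process x (a ## \<omega>) (u + v) = Some w'}"
      using all by blast
    show "emeasure Om {\<omega>. (\<forall>(t, z)\<in>A. process x (a ## \<omega>) t = Some z) \<and> visit x (a ## \<omega>) u 0 w \<and>
                process x (a ## \<omega>) (u + v) = Some w'} =
        (if ok then 1 else 0) * (indicator {u<..} (snd (a x)) * g (fst (a x), snd (a x) - u))"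
      unfolding eq using v by (cases "u < snd (a x)"; cases ok; cases "u + v < snd (a x)")
        (auto simp add: g_def process_Stream top indicator_def algebra_simps)
  qed
  also have "\<dots> = (if ok then 1 else 0) * (ennreal (exp (- q x * u)) * (\<integral>\<^sup>+a. g (a x) \<partial>tables))"
    using memoryless[OF g \<open>0 \<le> u\<close>, of x] by auto
  finally show ?case
    using emeasure_table_gt[OF \<open>0 \<le> u\<close>, of x] by (auto simp: 1 2[symmetric] ok_def)
next
  case (Suc n)
  note [measurable] = pred_process_all[OF \<open>finite A\<close>]
  \<comment> \<open>The observations from the first jump on, with times counted from that jump;
    those before it must all show \<open>x\<close>, which is \<open>early\<close>. The induction
    hypothesis is applied to this set, hence its generality in \<open>A\<close> and
    \<open>u\<close>.\<close>
  let ?B = "\<lambda>a. (\<lambda>(t, z). (t - snd (a x), z)) ` {(t, z) \<in> A. snd (a x) \<le> t}"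
  define early where "early a \<longleftrightarrow> (\<forall>(t, z)\<in>A. t < snd (a x) \<longrightarrow> z = x)"
    for a :: "'s \<Rightarrow> 's \<times> real"
  define later where "later a \<omega> \<longleftrightarrow> (\<forall>(t, z)\<in>?B a. process (fst (a x)) \<omega> t = Some z)"
    for a :: "'s \<Rightarrow> 's \<times> real" and \<omega>
  have all: "(\<forall>(t, z)\<in>A. process x (a ## \<omega>) t = Some z) \<longleftrightarrow> early a \<and> later a \<omega>" for a \<omega>
    unfolding early_def later_def by (force simp: process_Stream)
  have step: "emeasure Om {\<omega>. (\<forall>(t, z)\<in>A. process x (a ## \<omega>) t = Some z) \<and> visit x (a ## \<omega>) u (Suc n) w
                \<and> process x (a ## \<omega>) (u + v) = Some w'} =
      emeasure Om {\<omega>. (\<forall>(t, z)\<in>A. process x (a ## \<omega>) t = Some z) \<and> visit x (a ## \<omega>) u (Suc n) w} *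
      emeasure Om {\<omega>. process w \<omega> v = Some w'}" for a
  proof (cases "snd (a x) \<le> u \<and> early a")
    case True
    have "\<forall>(t, z)\<in>?B a. t \<le> u - snd (a x)" using Suc.prems by auto
    moreover have "finite (?B a)"
      using \<open>finite A\<close> by (auto intro: finite_subset)
    ultimately have "emeasure Om {\<omega>. later a \<omega> \<and>
        visit (fst (a x)) \<omega> (u - snd (a x)) n w \<and> process (fst (a x)) \<omega> (u - snd (a x) + v) = Some w'} =
      emeasure Om {\<omega>. later a \<omega> \<and> visit (fst (a x)) \<omega> (u - snd (a x)) n w} *
      emeasure Om {\<omega>. process w \<omega> v = Some w'}"
      unfolding later_def using True by (intro Suc.IH) auto
    moreover have "\<not> u + v < snd (a x)" "u - snd (a x) + v = u + v - snd (a x)"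
      using True v by auto
    ultimately show ?thesis
      unfolding all visit_Stream process_Stream[of x a _ "u + v"] using True by simp
  next
    case False
    then show ?thesis unfolding all visit_Stream by auto
  qed
  have "Measurable.pred Om (\<lambda>\<omega>. (\<forall>(t, z)\<in>A. process x \<omega> t = Some z) \<and> visit x \<omega> u (Suc n) w)"
    by measurable
  from borel_measurable_emeasure_Stream[OF this] show ?case
    by (subst (1 2) emeasure_first_step, measurable, simp only: step, intro nn_integral_multc)
qed


definition trans_prob :: "real \<Rightarrow> 's \<Rightarrow> 's \<Rightarrow> real" where
  "trans_prob t x z = measure Om {\<omega>. process x \<omega> t = Some z}"

lemma trans_prob_nonneg [simp]: "0 \<le> trans_prob t x z" and trans_prob_le_1: "trans_prob t x z \<le> 1"
  by (simp_all add: trans_prob_def)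

lemma emeasure_process: "emeasure Om {\<omega>. process x \<omega> t = Some z} = ennreal (trans_prob t x z)"
  by (simp add: trans_prob_def Om.emeasure_eq_measure)

lemma emeasure_UN_visit:
  assumes [measurable]: "Measurable.pred Om P"
  shows "emeasure Om {\<omega>. P \<omega> \<and> process x \<omega> t = Some z} = (\<Sum>n. emeasure Om {\<omega>. P \<omega> \<and> visit x \<omega> t n z})"
proof -
  have "Measurable.pred Om (\<lambda>\<omega>. P \<omega> \<and> visit x \<omega> t n z)" for n
    by measurable
  then have "(\<Sum>n. emeasure Om {\<omega>. P \<omega> \<and> visit x \<omega> t n z}) = emeasure Om (\<Union>n. {\<omega>. P \<omega> \<and> visit x \<omega> t n z})"
    by (intro suminf_emeasure) (auto simp: disjoint_family_on_def pred_def dest: visit_unique)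
  also have "(\<Union>n. {\<omega>. P \<omega> \<and> visit x \<omega> t n z}) = {\<omega>. P \<omega> \<and> process x \<omega> t = Some z}"
    by (auto simp: process_eq_Some_iff)
  finally show ?thesis ..
qed

lemma markov:
  assumes A: "finite A" "\<forall>(t, z)\<in>A. t \<le> u" and u: "0 \<le> u" and v: "0 \<le> v"
  shows "measure Om {\<omega>. (\<forall>(t, z)\<in>A. process x \<omega> t = Some z) \<and> process x \<omega> u = Some w \<and> process x \<omega> (u + v) = Some w'} =
    measure Om {\<omega>. (\<forall>(t, z)\<in>A. process x \<omega> t = Some z) \<and> process x \<omega> u = Some w} * trans_prob v w w'"
proof -
  note [measurable] = pred_process_all[OF \<open>finite A\<close>]
  let ?A = "\<lambda>\<omega>. \<forall>(t, z)\<in>A. process x \<omega> t = Some z"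
  have "emeasure Om {\<omega>. (?A \<omega> \<and> process x \<omega> (u + v) = Some w') \<and> process x \<omega> u = Some w} =
      (\<Sum>n. emeasure Om {\<omega>. (?A \<omega> \<and> process x \<omega> (u + v) = Some w') \<and> visit x \<omega> u n w})"
    by (rule emeasure_UN_visit) measurable
  also have "\<dots> = (\<Sum>n. emeasure Om {\<omega>. ?A \<omega> \<and> visit x \<omega> u n w \<and> process x \<omega> (u + v) = Some w'})"
    by (simp add: conj_ac)
  also have "\<dots> = (\<Sum>n. emeasure Om {\<omega>. ?A \<omega> \<and> visit x \<omega> u n w} * ennreal (trans_prob v w w'))"
    by (simp only: markov_visit[OF A u v] emeasure_process)
  also have "\<dots> = emeasure Om {\<omega>. ?A \<omega> \<and> process x \<omega> u = Some w} * ennreal (trans_prob v w w')"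
    by (simp only: emeasure_UN_visit[OF pred_process_all[OF A(1)]] ennreal_suminf_multc)
  finally show ?thesis
    by (simp add: Om.emeasure_eq_measure conj_ac flip: ennreal_mult)
qed

text \<open>The Markov property is applied at the last time but one, repeatedly. Times need only
  increase weakly, so that several requirements at one time are covered.\<close>

lemma fin_dim_trans:
  assumes "0 \<le> t 0" "\<And>i. i < m \<Longrightarrow> t i \<le> t (Suc i)"
  shows "measure Om {\<omega>. \<forall>i\<le>m. process x \<omega> (t i) = Some (z i)} =
    trans_prob (t 0) x (z 0) * (\<Prod>i<m. trans_prob (t (Suc i) - t i) (z i) (z (Suc i)))"
  using assms(2)
proof (induction m)
  case 0
  then show ?case by (simp add: trans_prob_def)
next
  case (Suc m)
  have mono: "i \<le> j \<Longrightarrow> j \<le> m \<Longrightarrow> t i \<le> t j" for i j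
  proof (induction j)
    case (Suc j)
    then show ?case using Suc.prems \<open>\<And>i. i < Suc m \<Longrightarrow> t i \<le> t (Suc i)\<close>[of j] by (cases "i = Suc j") auto
  qed simp
  have "0 \<le> t m" using mono[of 0 m] assms(1) by simp
  let ?A = "(\<lambda>i. (t i, z i)) ` {..m}"
  have *: "\<forall>(s, z)\<in>?A. s \<le> t m" using mono by auto
  have "{\<omega>. \<forall>i\<le>Suc m. process x \<omega> (t i) = Some (z i)} =
      {\<omega>. (\<forall>(s, z)\<in>?A. process x \<omega> s = Some z) \<and> process x \<omega> (t m) = Some (z m)
          \<and> process x \<omega> (t m + (t (Suc m) - t m)) = Some (z (Suc m))}"
    (is "?L = ?R")
  proof -
    have "(\<forall>i\<le>Suc m. process x \<omega> (t i) = Some (z i)) \<longleftrightarrow>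
        (\<forall>i\<le>m. process x \<omega> (t i) = Some (z i)) \<and> process x \<omega> (t (Suc m)) = Some (z (Suc m))" for \<omega>
      using le_Suc_eq by auto
    then show "?L = ?R" by auto
  qed
  also have "measure Om \<dots> = measure Om {\<omega>. (\<forall>(s, z)\<in>?A. process x \<omega> s = Some z) \<and>
      process x \<omega> (t m) = Some (z m)} * trans_prob (t (Suc m) - t m) (z m) (z (Suc m))"
    by (rule markov[OF _ * \<open>0 \<le> t m\<close>]) (use Suc.prems[of m] in auto)
  also have "{\<omega>. (\<forall>(s, z)\<in>?A. process x \<omega> s = Some z) \<and> process x \<omega> (t m) = Some (z m)} =
      {\<omega>. \<forall>i\<le>m. process x \<omega> (t i) = Some (z i)}"
    by auto
  finally show ?case using Suc by (simp add: mult.assoc)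
qed

section \<open>Transition probabilities with a fixed number of jumps\<close>

abbreviation jump_rate :: "'s \<Rightarrow> 's \<Rightarrow> ennreal" where "jump_rate x y \<equiv> ennreal (q x * pmf (p x) y)"

definition stay :: "'s \<Rightarrow> real \<Rightarrow> ennreal" where
  "stay x t = ennreal (exp (- q x * t)) * indicator {0..} t"

abbreviation steps :: "('s \<times> real) measure" where "steps \<equiv> count_space UNIV \<Otimes>\<^sub>M lborel"

text \<open>
  The probability of going from \<open>x\<close> to \<open>z\<close> in time \<open>t\<close> with exactly \<open>n\<close> jumps; it is \<open>0\<close> for
  \<open>t < 0\<close>, so that all time integrals can be taken over the whole line.
\<close>

primrec jump_trans :: "nat \<Rightarrow> real \<Rightarrow> 's \<Rightarrow> 's \<Rightarrow> ennreal" where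
  "jump_trans 0 t x z = (if x = z then stay x t else 0)"
| "jump_trans (Suc n) t x z = (\<integral>\<^sup>+(y, s). jump_rate x y * stay x s * jump_trans n (t - s) y z \<partial>steps)"

lemma sigma_finite_steps: "sigma_finite_measure steps"
proof -
  interpret sigma_finite_measure "count_space (UNIV :: 's set)"
    by (rule sigma_finite_measure_count_space)
  interpret pair_sigma_finite "count_space (UNIV :: 's set)" lborel ..
  show ?thesis ..
qed

sublocale steps: sigma_finite_measure steps by (rule sigma_finite_steps)

lemma measurable_stay [measurable (raw)]:
  assumes [measurable]: "f \<in> measurable N (count_space UNIV)" "g \<in> borel_measurable N"
  shows "(\<lambda>w. stay (f w) (g w)) \<in> borel_measurable N"
  unfolding stay_def by measurable

lemma measurable_jump_trans_time: "(\<lambda>t. jump_trans n t x z) \<in> borel_measurable borel"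
proof (induction n arbitrary: x z)
  case 0
  show ?case unfolding jump_trans.simps by measurable
next
  case (Suc n)
  have "(\<lambda>w. jump_trans n (fst w - snd (snd w)) y z) \<in> borel_measurable (borel \<Otimes>\<^sub>M steps)" for y
    by (rule measurable_compose[OF _ Suc]) measurable
  then have [measurable]: "(\<lambda>w. jump_trans n (fst w - snd (snd w)) (fst (snd w)) z) \<in> borel_measurable (borel \<Otimes>\<^sub>M steps)"
    by (rule measurable_compose_countable) measurable
  show ?case
    unfolding jump_trans.simps case_prod_beta
    by (rule steps.borel_measurable_nn_integral) measurable
qed

lemma measurable_jump_trans [measurable (raw)]:
  assumes [measurable]: "f \<in> borel_measurable N" "g \<in> measurable N (count_space UNIV)" "h \<in> measurable N (count_space UNIV)"
  shows "(\<lambda>w. jump_trans n (f w) (g w) (h w)) \<in> borel_measurable N"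
proof -
  have "(\<lambda>w. jump_trans n (f w) x z) \<in> borel_measurable N" for x z
    by (rule measurable_compose[OF assms(1) measurable_jump_trans_time])
  then have "(\<lambda>w. jump_trans n (f w) x (h w)) \<in> borel_measurable N" for x
    by (rule measurable_compose_countable) fact
  then show ?thesis
    by (rule measurable_compose_countable) fact
qed

lemma jump_trans_neg: "t < 0 \<Longrightarrow> jump_trans n t x z = 0"
proof (induction n arbitrary: t x)
  case 0 then show ?case by (simp add: stay_def)
next
  case (Suc n)
  have "jump_rate x y * stay x s * jump_trans n (t - s) y z = 0" for y s
    using Suc.IH[of "t - s" y] Suc.prems by (cases "0 \<le> s") (auto simp: stay_def)
  then show ?case by (simp only: jump_trans.simps case_prod_beta' nn_integral_const mult_zero_left)
qed

lemma nn_integral_steps: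
  assumes "(\<lambda>(y, s). g y s) \<in> borel_measurable steps"
  shows "(\<integral>\<^sup>+(y, s). g y s \<partial>steps) = (\<integral>\<^sup>+y. (\<integral>\<^sup>+s. g y s \<partial>lborel) \<partial>count_space UNIV)"
  using lborel.nn_integral_fst[OF assms] by simp

lemma emeasure_visit: "0 \<le> t \<Longrightarrow> emeasure Om {\<omega>. visit x \<omega> t n z} = jump_trans n t x z"
proof (induction n arbitrary: t x)
  case 0
  have "emeasure Om UNIV = 1" using Om.emeasure_space_1 by simp
  then have "emeasure Om {\<omega>. visit x \<omega> t 0 z} =
      (\<integral>\<^sup>+a. indicator {t<..} (snd (a x)) * (if x = z then 1 else 0) \<partial>tables)"
    by (subst emeasure_first_step, measurable, intro nn_integral_cong) (simp add: visit_Stream indicator_def)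
  then show ?case using emeasure_table_gt[OF \<open>0 \<le> t\<close>, of x] 0 by (cases "x = z") (simp_all add: stay_def)
next
  case (Suc n)
  have [measurable]: "(\<lambda>w. jump_trans n (t - snd w) (fst w) z) \<in> borel_measurable (count_space UNIV \<Otimes>\<^sub>M borel)" 
    by measurable
  have [measurable]: "(\<lambda>s. jump_trans n (t - s) y z) \<in> borel_measurable borel" for y
    by measurable
  have "emeasure Om {\<omega>. visit x \<omega> t (Suc n) z} = (\<integral>\<^sup>+a. jump_trans n (t - snd (a x)) (fst (a x)) z \<partial>tables)"
  proof (subst emeasure_first_step, measurable, rule nn_integral_cong)
    fix a
    \<comment> \<open>If the holding time exceeds \<open>t\<close> the event is empty, which matches
      the value \<open>0\<close> of \<open>jump_trans\<close> at negative times.\<close>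
    show "emeasure Om {\<omega>. visit x (a ## \<omega>) t (Suc n) z} = jump_trans n (t - snd (a x)) (fst (a x)) z"
      by (cases "snd (a x) \<le> t") (simp_all add: visit_Stream Suc.IH jump_trans_neg)
  qed
  also have "\<dots> = (\<integral>\<^sup>+y. (\<integral>\<^sup>+s. ennreal (exponential_density (q x) s) * jump_trans n (t - s) y z \<partial>lborel) \<partial>p x)"
    using nn_integral_table[of "\<lambda>w. jump_trans n (t - snd w) (fst w) z" x] by simp
  \<comment> \<open>The exponential density is \<open>q x\<close> times the survival function
    \<open>stay x\<close>; the factor \<open>q x\<close> joins the jump probability to form
    \<open>jump_rate\<close>.\<close>
  also have "\<dots> = (\<integral>\<^sup>+y. (\<integral>\<^sup>+s. jump_rate x y * stay x s * jump_trans n (t - s) y z \<partial>lborel) \<partial>count_space UNIV)"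
    by (subst nn_integral_measure_pmf, intro nn_integral_cong, subst nn_integral_cmult[symmetric], measurable, intro nn_integral_cong)
       (auto simp: stay_def exponential_density_def ennreal_mult mult_ac)
  also have "\<dots> = jump_trans (Suc n) t x z"
    unfolding jump_trans.simps by (rule nn_integral_steps[symmetric]) measurable
  finally show ?case .
qed

lemma emeasure_process_sum: "0 \<le> t \<Longrightarrow> ennreal (trans_prob t x z) = (\<Sum>n. jump_trans n t x z)"
  using emeasure_UN_visit[of "\<lambda>_. True" x t z] by (simp add: emeasure_process emeasure_visit)

text \<open>The claim is applied to the path after the first jump, the integrations over the first
  and the last jump are exchanged, and the inner one is again a first-jump recursion. For a single
  jump, substituting \<open>t - s\<close> for \<open>s\<close> swaps the two holding
  periods.\<close>

lemma jump_trans_last_jump: "jump_trans (Suc n) t x z = (\<integral>\<^sup>+(w, v). jump_rate w z * stay z v * jump_trans n (t - v) x w \<partial>steps)"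
proof (induction n arbitrary: t x)
  case 0
  have "jump_trans (Suc 0) t x z = (\<integral>\<^sup>+y. (\<integral>\<^sup>+s. jump_rate x y * stay x s * jump_trans 0 (t - s) y z \<partial>lborel) \<partial>count_space UNIV)"
    unfolding jump_trans.simps(2) by (rule nn_integral_steps) measurable
  also have "\<dots> = (\<integral>\<^sup>+y. (if y = z then (\<integral>\<^sup>+s. jump_rate x z * stay x s * stay z (t - s) \<partial>lborel) else 0) \<partial>count_space UNIV)"
    by (intro nn_integral_cong) simp
  also have "\<dots> = (\<integral>\<^sup>+s. jump_rate x z * stay x s * stay z (t - s) \<partial>lborel)"
    by (rule nn_integral_count_space_single)
  also have "\<dots> = (\<integral>\<^sup>+v. jump_rate x z * stay z v * stay x (t - v) \<partial>lborel)"
    by (subst nn_integral_real_affine[where c="-1" and t=t]) (auto simp: mult_ac)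
  also have "\<dots> = (\<integral>\<^sup>+w. (if w = x then (\<integral>\<^sup>+v. jump_rate x z * stay z v * stay x (t - v) \<partial>lborel) else 0) \<partial>count_space UNIV)"
    by (rule nn_integral_count_space_single[symmetric])
  also have "\<dots> = (\<integral>\<^sup>+w. (\<integral>\<^sup>+v. jump_rate w z * stay z v * jump_trans 0 (t - v) x w \<partial>lborel) \<partial>count_space UNIV)"
    by (intro nn_integral_cong) simp
  also have "\<dots> = (\<integral>\<^sup>+(w, v). jump_rate w z * stay z v * jump_trans 0 (t - v) x w \<partial>steps)"
    by (rule nn_integral_steps[symmetric]) measurable
  finally show ?case .
next
  case (Suc n)
  interpret pair_sigma_finite steps steps ..
  let ?F = "\<lambda>(y, s) (w, v). jump_rate x y * stay x s * (jump_rate w z * stay z v * jump_trans n (t - s - v) y w)"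
  have F [measurable]: "case_prod ?F \<in> borel_measurable (steps \<Otimes>\<^sub>M steps)"
    unfolding case_prod_beta by measurable
  have "jump_trans (Suc (Suc n)) t x z = (\<integral>\<^sup>+a. (\<integral>\<^sup>+b. ?F a b \<partial>steps) \<partial>steps)"
    by (subst jump_trans.simps(2), intro nn_integral_cong, simp only: Suc.IH case_prod_beta', subst nn_integral_cmult[symmetric]) auto
  also have "\<dots> = (\<integral>\<^sup>+b. (\<integral>\<^sup>+a. ?F a b \<partial>steps) \<partial>steps)"
    by (rule Fubini'[OF F, symmetric])
  also have "\<dots> = (\<integral>\<^sup>+(w, v). jump_rate w z * stay z v * jump_trans (Suc n) (t - v) x w \<partial>steps)"
    by (intro nn_integral_cong, simp only: jump_trans.simps(2) case_prod_beta', subst nn_integral_cmult[symmetric])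
       (auto simp: mult_ac diff_diff_eq add.commute)
  finally show ?case .
qed

text \<open>Balance reverses the first jump from \<open>x\<close> to \<open>y\<close>, the induction
  hypothesis reverses the remaining path from \<open>y\<close> to \<open>z\<close>, and the result
  is the integrand of the last-jump recursion for paths from \<open>z\<close> to
  \<open>x\<close>.\<close>

lemma jump_trans_symmetric:
  fixes W :: "'s \<Rightarrow> ennreal"
  assumes bal: "\<And>x y. W x * jump_rate x y = W y * jump_rate y x"
  shows "W x * jump_trans n t x z = W z * jump_trans n t z x"
proof (induction n arbitrary: t x)
  case 0
  then show ?case by simp
next
  case (Suc n)
  have *: "W x * (jump_rate x y * stay x s * jump_trans n (t - s) y z) = W z * (jump_rate y x * stay x s * jump_trans n (t - s) z y)" for y s
  proof -
    have "W x * (jump_rate x y * stay x s * jump_trans n (t - s) y z) = (W x * jump_rate x y) * stay x s * jump_trans n (t - s) y z"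
      by (simp only: mult.assoc)
    also have "\<dots> = (W y * jump_trans n (t - s) y z) * (jump_rate y x * stay x s)"
      unfolding bal[of x y] by (simp only: mult_ac)
    also have "\<dots> = W z * (jump_rate y x * stay x s * jump_trans n (t - s) z y)"
      unfolding Suc.IH by (simp only: mult_ac)
    finally show ?thesis .
  qed
  have "W x * jump_trans (Suc n) t x z = (\<integral>\<^sup>+w. W x * (jump_rate x (fst w) * stay x (snd w) * jump_trans n (t - snd w) (fst w) z) \<partial>steps)"
    by (subst nn_integral_cmult) (auto simp: case_prod_beta')
  also have "\<dots> = (\<integral>\<^sup>+w. W z * (jump_rate (fst w) x * stay x (snd w) * jump_trans n (t - snd w) z (fst w)) \<partial>steps)"
    by (simp only: *)
  also have "\<dots> = W z * jump_trans (Suc n) t z x"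
    by (subst nn_integral_cmult) (auto simp: jump_trans_last_jump case_prod_beta' simp del: jump_trans.simps)
  finally show ?case .
qed

lemma trans_prob_symmetric:
  fixes W :: "'s \<Rightarrow> real"
  assumes W: "\<And>x. 0 \<le> W x" and bal: "\<And>x y. W x * (q x * pmf (p x) y) = W y * (q y * pmf (p y) x)" and t: "0 \<le> t"
  shows "W x * trans_prob t x z = W z * trans_prob t z x"
proof -
  have "ennreal (W x) * jump_rate x y = ennreal (W y) * jump_rate y x" for x y
    using bal[of x y] W by (simp flip: ennreal_mult)
  from jump_trans_symmetric[OF this]
  have "ennreal (W x) * ennreal (trans_prob t x z) = ennreal (W z) * ennreal (trans_prob t z x)"
    by (simp add: emeasure_process_sum[OF t] flip: ennreal_suminf_cmult)
  then show ?thesis using W by (simp flip: ennreal_mult)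
qed

subsection \<open>Excursions\<close>

text \<open>Supplies the increasing jump times on which \<open>return_time_le\<close>
  relies.\<close>

lemma AE_holding_time_pos: "AE \<omega> in Om. \<forall>n. 0 < holding_time x \<omega> n"
proof -
  have [simp]: "emeasure Om UNIV = 1" using Om.emeasure_space_1 by simp
  have "emeasure Om {\<omega>. 0 < holding_time x \<omega> n} = 1" for n
  proof (induction n arbitrary: x)
    case 0
    have "emeasure Om {\<omega>. 0 < holding_time x \<omega> 0} = (\<integral>\<^sup>+a. indicator {0<..} (snd (a x)) \<partial>tables)"
    proof (subst emeasure_first_step, measurable, rule nn_integral_cong)
      show "emeasure Om {\<omega>. 0 < holding_time x (a ## \<omega>) 0} = indicator {0<..} (snd (a x))" for a
        by (cases "0 < snd (a x)") simp_all
    qed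
    then show ?case using emeasure_table_gt[of 0 x] by simp
  next
    case (Suc n)
    show ?case
      by (subst emeasure_first_step, measurable) (simp add: Suc tables.emeasure_space_1[simplified])
  qed
  then have "AE \<omega> in Om. 0 < holding_time x \<omega> n" for n
    using Om.AE_iff_emeasure_eq_1[of "\<lambda>\<omega>. 0 < holding_time x \<omega> n"] by simp
  then show ?thesis unfolding AE_all_countable ..
qed

text \<open>The expected contribution of the \<open>n\<close>-th holding time to an excursion away from \<open>x\<^sub>0\<close>.\<close>

primrec excursion :: "'s \<Rightarrow> nat \<Rightarrow> 's \<Rightarrow> ennreal" where
  "excursion x0 0 x = ennreal (1 / q x)"
| "excursion x0 (Suc n) x = (\<integral>\<^sup>+y. indicator (- {x0}) y * excursion x0 n y \<partial>p x)"

text \<open>The probability that the jump chain hits \<open>x0\<close> for the first time after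
  exactly \<open>n + 1\<close> jumps; being in \<open>x0\<close> at the start does not count as a
  hit.\<close>

primrec first_hit :: "'s \<Rightarrow> nat \<Rightarrow> 's \<Rightarrow> ennreal" where
  "first_hit x0 0 x = ennreal (pmf (p x) x0)"
| "first_hit x0 (Suc n) x = (\<integral>\<^sup>+y. indicator (- {x0}) y * first_hit x0 n y \<partial>p x)"

lemma nn_integral_holding_time:
  "(\<integral>\<^sup>+\<omega>. ennreal (holding_time x \<omega> n) * indicator {\<omega>. \<forall>m<n. jump_chain x \<omega> (Suc m) \<noteq> x0} \<omega> \<partial>Om) = excursion x0 n x"
proof (induction n arbitrary: x)
  case 0
  have m: "(\<lambda>z. ennreal (snd z)) \<in> borel_measurable (count_space UNIV \<Otimes>\<^sub>M borel)"
    by measurable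
  have "(\<integral>\<^sup>+\<omega>. ennreal (holding_time x \<omega> 0) \<partial>Om) = (\<integral>\<^sup>+a. ennreal (snd (a x)) \<partial>tables)"
    by (subst nn_integral_first_step, measurable) (simp add: Om.emeasure_space_1[simplified])
  also have "\<dots> = (\<integral>\<^sup>+y. (\<integral>\<^sup>+s. ennreal (exponential_density (q x) s * s) \<partial>lborel) \<partial>p x)"
    using nn_integral_table[OF m, of x] by (simp add: ennreal_mult' exponential_density_nonneg)
  \<comment> \<open>The mean of the exponential law, as first moment of the Erlang law with index
    0.\<close>
  also have "(\<integral>\<^sup>+s. ennreal (exponential_density (q x) s * s) \<partial>lborel) = ennreal (1 / q x)"
    using nn_integral_erlang_ith_moment[of "q x" 0 1] by (simp add: divide_ennreal)
  finally show ?case by simp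
next
  case (Suc n)
  let ?f = "\<lambda>y. indicator (- {x0}) y * excursion x0 n y"
  interpret X: prob_space "density lborel (exponential_density (q x))"
    by (rule prob_space_exponential_density) simp
  have dens: "(\<integral>\<^sup>+s. ennreal (exponential_density (q x) s) * b \<partial>lborel) = b" for b
    using X.emeasure_space_1 by (subst nn_integral_multc) (auto simp: emeasure_density)
  have ind: "indicator {\<omega>. \<forall>m<Suc n. jump_chain x \<omega> (Suc m) \<noteq> x0} (a ## \<omega>) =
    (indicator (- {x0}) (fst (a x)) * indicator {\<omega>. \<forall>m<n. jump_chain (fst (a x)) \<omega> (Suc m) \<noteq> x0} \<omega> :: ennreal)" for a \<omega>
    unfolding All_less_Suc2 by (simp add: indicator_def)
  have m: "(\<lambda>z. ?f (fst z)) \<in> borel_measurable (count_space UNIV \<Otimes>\<^sub>M borel)"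
    by measurable
  have [measurable]: "{\<omega>. \<forall>m<n. jump_chain x \<omega> (Suc m) \<noteq> x0} \<in> sets Om" for n x
  proof -
    have "Measurable.pred Om (\<lambda>\<omega>. \<forall>m<n. jump_chain x \<omega> (Suc m) \<noteq> x0)" by measurable
    then show ?thesis by (simp add: pred_def)
  qed
  have "(\<integral>\<^sup>+\<omega>. ennreal (holding_time x \<omega> (Suc n)) * indicator {\<omega>. \<forall>m<Suc n. jump_chain x \<omega> (Suc m) \<noteq> x0} \<omega> \<partial>Om) =
      (\<integral>\<^sup>+a. (\<integral>\<^sup>+\<omega>. indicator (- {x0}) (fst (a x)) * (ennreal (holding_time (fst (a x)) \<omega> n) *
        indicator {\<omega>. \<forall>m<n. jump_chain (fst (a x)) \<omega> (Suc m) \<noteq> x0} \<omega>) \<partial>Om) \<partial>tables)"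
    by (subst nn_integral_first_step, measurable) (simp only: ind holding_time_Stream mult_ac)
  also have "\<dots> = (\<integral>\<^sup>+a. ?f (fst (a x)) \<partial>tables)"
    by (subst nn_integral_cmult, measurable) (simp only: Suc)
  also have "\<dots> = (\<integral>\<^sup>+y. ?f y \<partial>p x)"
    using nn_integral_table[OF m, of x] by (simp add: dens)
  finally show ?case by simp
qed

text \<open>First hits after different numbers of jumps exclude each other: either the first jump
  hits \<open>x0\<close>, or the next state contributes at most 1 by induction.\<close>

lemma sum_first_hit_le_1: "(\<Sum>n<N. first_hit x0 n x) \<le> 1"
proof (induction N arbitrary: x)
  case (Suc N)
  have "(\<Sum>n<Suc N. first_hit x0 n x) =
      first_hit x0 0 x + (\<Sum>n<N. \<integral>\<^sup>+y. indicator (- {x0}) y * first_hit x0 n y \<partial>p x)"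
    unfolding sum.lessThan_Suc_shift by simp
  also have "\<dots> = emeasure (p x) {x0} + (\<integral>\<^sup>+y. indicator (- {x0}) y * (\<Sum>n<N. first_hit x0 n y) \<partial>p x)"
    by (subst nn_integral_sum[symmetric]) (auto simp: sum_distrib_left emeasure_pmf_single)
  also have "\<dots> \<le> emeasure (p x) {x0} + (\<integral>\<^sup>+y. indicator (- {x0}) y \<partial>p x)"
  proof (intro add_left_mono nn_integral_mono)
    fix y
    show "indicator (- {x0}) y * (\<Sum>n<N. first_hit x0 n y) \<le> indicator (- {x0}) y"
      using mult_left_mono[OF Suc[of y], of "indicator (- {x0}) y"] by simp
  qed
  also have "\<dots> = emeasure (p x) {x0} + emeasure (p x) (- {x0})" by simp
  also have "\<dots> = emeasure (p x) UNIV"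
    by (subst plus_emeasure) (auto intro: arg_cong2[where f=emeasure])
  also have "\<dots> = 1" using measure_pmf.emeasure_space_1[of "p x"] by simp
  finally show ?case .
qed simp

end

section \<open>Reversible processes with finite levels\<close>

text \<open>Translates real sums into nonnegative integrals, where Tonelli and monotonicity apply
  without summability proofs.\<close>

lemma has_sum_nn_integral_count_space:
  fixes f :: "'a \<Rightarrow> real"
  assumes f: "\<And>x. x \<in> A \<Longrightarrow> 0 \<le> f x" and r: "0 \<le> r"
  shows "(f has_sum r) A \<longleftrightarrow> (\<integral>\<^sup>+x. ennreal (f x) \<partial>count_space A) = ennreal r"
proof
  assume *: "(f has_sum r) A"
  then have "f summable_on A" by (auto simp: summable_on_def)
  then have "(\<lambda>x. norm (f x)) summable_on A" using f by (subst summable_on_cong[of _ _ f]) auto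
  then have a: "Infinite_Set_Sum.abs_summable_on f A" by (rule abs_summable_equivalent[THEN iffD1])
  from nn_integral_conv_infsetsum[OF this f] show "(\<integral>\<^sup>+x. ennreal (f x) \<partial>count_space A) = ennreal r"
    using infsetsum_infsum[OF a] infsumI[OF *] by simp
next
  assume *: "(\<integral>\<^sup>+x. ennreal (f x) \<partial>count_space A) = ennreal r"
  then have a: "Infinite_Set_Sum.abs_summable_on f A"
    unfolding abs_summable_on_def using f
    by (intro integrableI_nonneg) (auto simp: AE_count_space)
  then have "f summable_on A"
    by (auto simp: abs_summable_equivalent[symmetric] intro: abs_summable_summable)
  moreover have "infsum f A = r"
    using infsetsum_conv_nn_integral[of A f] * f r infsetsum_infsum[OF a] by simp
  ultimately show "(f has_sum r) A" using has_sum_infsum by blast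
qed

text \<open>The exit rate \<open>q\<close> may be unbounded on \<open>E\<close>; non-explosion rests
  on \<open>finite_level\<close> together with \<open>level_rate\<close>. With \<open>W\<close> zero
  off \<open>E\<close>, \<open>balance\<close> can be required of all states of the type, which is
  the form in which \<open>trans_prob_symmetric\<close> uses it.\<close>

locale reversible_jump_process = jump_process Q for Q :: "'s::countable \<Rightarrow> 's \<Rightarrow> real" +
  fixes E :: "'s set" and W :: "'s \<Rightarrow> real" and level :: "'s \<Rightarrow> nat" and C :: real
  assumes W_pos: "x \<in> E \<Longrightarrow> 0 < W x"
    and W_zero: "x \<notin> E \<Longrightarrow> W x = 0"
    and W_sum: "(W has_sum 1) E"
    and closed: "x \<in> E \<Longrightarrow> set_pmf (p x) \<subseteq> E"
    and balance: "W x * (q x * pmf (p x) y) = W y * (q y * pmf (p y) x)"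
    and C_nonneg: "0 \<le> C"
    and finite_level: "finite {x \<in> E. level x = k}"
    and level_rate: "x \<in> E \<Longrightarrow> q x * measure (p x) {y. level y \<noteq> level x} \<le> C"
    and irreducible: "x \<in> E \<Longrightarrow> y \<in> E \<Longrightarrow> (x, y) \<in> {(x, y). 0 < pmf (p x) y}\<^sup>*"
begin

lemma W_nonneg [simp]: "0 \<le> W x"
  using W_pos[of x] W_zero[of x] by (cases "x \<in> E") auto

subsection \<open>Non-explosion\<close>

text \<open>
  The Laplace transform of the \<open>n\<close>-th jump time, at an argument exceeding the bound \<open>C\<close> on the rate
  of changes of the level.
\<close>

primrec laplace :: "nat \<Rightarrow> 's \<Rightarrow> real" where
  "laplace 0 x = 1"
| "laplace (Suc n) x = q x / (q x + (C + 1)) * measure_pmf.expectation (p x) (laplace n)"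

lemma rate_pos: "0 < q x + (C + 1)"
  using C_nonneg q_pos[of x] by linarith

lemma laplace_bounds: "0 \<le> laplace n x \<and> laplace n x \<le> 1"
proof (induction n arbitrary: x)
  case (Suc n)
  have "integrable (p x) (laplace n)"
    using Suc by (auto intro!: measure_pmf.integrable_const_bound[where B=1])
  then have "0 \<le> measure_pmf.expectation (p x) (laplace n)" "measure_pmf.expectation (p x) (laplace n) \<le> 1"
    using Suc measure_pmf.integral_le_const[of "p x" "laplace n" 1] by (auto intro!: integral_nonneg_AE)
  moreover have "0 \<le> q x / (q x + (C + 1))" "q x / (q x + (C + 1)) \<le> 1"
    using rate_pos[of x] C_nonneg by (auto simp: divide_simps)
  ultimately show ?case
    unfolding laplace.simps by (intro conjI mult_nonneg_nonneg mult_le_one)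
qed simp

lemma integrable_laplace: "integrable (p x) (laplace n)"
  using laplace_bounds by (auto intro!: measure_pmf.integrable_const_bound[where B=1])

lemma laplace_decreasing: "laplace (Suc n) x \<le> laplace n x"
proof (induction n arbitrary: x)
  case 0
  then show ?case using laplace_bounds[of "Suc 0" x] by simp
next
  case (Suc n)
  have "measure_pmf.expectation (p x) (laplace (Suc n)) \<le> measure_pmf.expectation (p x) (laplace n)"
    by (intro integral_mono integrable_laplace Suc)
  then show ?case
    unfolding laplace.simps(2)[of "Suc n" x] laplace.simps(2)[of n x]
    using rate_pos[of x] by (intro mult_left_mono) auto
qed

text \<open>The Laplace transform of the explosion time at \<open>C + 1\<close>: it vanishes at
  \<open>x\<close> exactly if the process from \<open>x\<close> almost surely does not
  explode.\<close>

definition laplace_lim :: "'s \<Rightarrow> real" where "laplace_lim x = lim (\<lambda>n. laplace n x)"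

lemma laplace_tendsto: "(\<lambda>n. laplace n x) \<longlonglongrightarrow> laplace_lim x"
proof -
  have "decseq (\<lambda>n. laplace n x)" by (intro decseq_SucI laplace_decreasing)
  moreover have "\<forall>n. 0 \<le> laplace n x" using laplace_bounds by blast
  ultimately have "convergent (\<lambda>n. laplace n x)"
    by (metis decseq_convergent convergent_def)
  then show ?thesis by (simp add: laplace_lim_def convergent_LIMSEQ_iff)
qed

lemma laplace_lim_bounds: "0 \<le> laplace_lim x" "laplace_lim x \<le> 1"
  using laplace_bounds laplace_tendsto[of x] by (auto intro: LIMSEQ_le_const LIMSEQ_le_const2)

lemma integrable_laplace_lim: "integrable (p x) laplace_lim"
  using laplace_lim_bounds by (auto intro!: measure_pmf.integrable_const_bound[where B=1])

text \<open>Dominated convergence in the recursion. The limit is a bounded nonnegative eigenfunction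
  of the generator with eigenvalue \<open>C + 1\<close>; as in Reuter's criterion, non-explosion
  follows once it is shown to vanish.\<close>

lemma laplace_lim_eq: "(q x + (C + 1)) * laplace_lim x = q x * measure_pmf.expectation (p x) laplace_lim"
proof -
  have "(\<lambda>n. measure_pmf.expectation (p x) (laplace n)) \<longlonglongrightarrow> measure_pmf.expectation (p x) laplace_lim"
    using laplace_bounds by (intro integral_dominated_convergence[where w="\<lambda>_. 1"]) (auto intro: laplace_tendsto)
  then have "(\<lambda>n. laplace (Suc n) x) \<longlonglongrightarrow> q x / (q x + (C + 1)) * measure_pmf.expectation (p x) laplace_lim"
    unfolding laplace.simps by (intro tendsto_mult_left)
  moreover have "(\<lambda>n. laplace (Suc n) x) \<longlonglongrightarrow> laplace_lim x"
    using laplace_tendsto by (rule LIMSEQ_Suc)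
  ultimately have "laplace_lim x = q x / (q x + (C + 1)) * measure_pmf.expectation (p x) laplace_lim"
    by (rule LIMSEQ_unique[rotated])
  then show ?thesis using rate_pos[of x] by (simp add: field_simps)
qed

text \<open>
  At a maximum point of \<open>laplace_lim\<close> on a level, only the transitions to other levels can push the
  mean of \<open>laplace_lim\<close> over the next state above the value at that point, and their rate is at most \<open>C\<close>.
\<close>

lemma laplace_lim_zero:
  assumes "x \<in> E"
  shows "laplace_lim x = 0"
proof -
  define s where "s = (SUP x\<in>E. laplace_lim x)"
  have bdd: "bdd_above (laplace_lim ` E)" using laplace_lim_bounds by (auto intro!: bdd_aboveI[where M=1])
  have le_s: "laplace_lim y \<le> s" if "y \<in> E" for y
    unfolding s_def using bdd that by (rule cSUP_upper2) simp
  have s0: "0 \<le> s" using le_s[OF assms] laplace_lim_bounds(1)[of x] by linarith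
  have le: "(C + 1) * laplace_lim y \<le> C * s" if y: "y \<in> E" for y
  proof -
    let ?L = "{z \<in> E. level z = level y}"
    have "finite (laplace_lim ` ?L)" "laplace_lim ` ?L \<noteq> {}" using finite_level y by auto
    from Max_in[OF this] obtain m where m: "m \<in> ?L" "laplace_lim m = Max (laplace_lim ` ?L)" by auto
    have max: "laplace_lim z \<le> laplace_lim m" if "z \<in> ?L" for z
      unfolding m(2) using that finite_level by (intro Max_ge) auto
    let ?D = "{z. level z \<noteq> level m}"
    have int: "integrable (p m) (indicator ?D :: 's \<Rightarrow> real)"
      by (auto intro!: measure_pmf.integrable_const_bound[where B=1] simp: indicator_def)
    have "measure_pmf.expectation (p m) laplace_lim \<le> measure_pmf.expectation (p m) (\<lambda>z. laplace_lim m + s * indicator ?D z)"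
    proof (rule integral_mono_AE)
      show "integrable (p m) (\<lambda>z. laplace_lim m + s * indicator ?D z)"
        by (intro Bochner_Integration.integrable_add integrable_mult_right int) simp
      have "laplace_lim z \<le> laplace_lim m + s * indicator ?D z" if "z \<in> E" for z
        using max[of z] le_s[OF that] that m(1) laplace_lim_bounds(1)[of m] by (auto simp: indicator_def)
      then show "AE z in p m. laplace_lim z \<le> laplace_lim m + s * indicator ?D z"
        using closed m(1) by (auto simp: AE_measure_pmf_iff)
    qed (rule integrable_laplace_lim)
    also have "\<dots> = laplace_lim m + s * measure (p m) ?D"
      using int by (subst Bochner_Integration.integral_add) auto
    finally have "(q m + (C + 1)) * laplace_lim m \<le> q m * (laplace_lim m + s * measure (p m) ?D)"
      unfolding laplace_lim_eq by (intro mult_left_mono) auto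
    moreover have "s * (q m * measure (p m) ?D) \<le> s * C"
      using level_rate[of m] m(1) s0 by (intro mult_left_mono) auto
    ultimately have "(C + 1) * laplace_lim m \<le> C * s" by (simp add: algebra_simps)
    moreover have "(C + 1) * laplace_lim y \<le> (C + 1) * laplace_lim m"
      using max[of y] y C_nonneg by (intro mult_left_mono) auto
    ultimately show ?thesis by simp
  qed
  \<comment> \<open>The supremum is contracted by a factor less than 1; this is why the Laplace
    argument was chosen above \<open>C\<close>.\<close>
  have "s \<le> C * s / (C + 1)"
    unfolding s_def using assms le C_nonneg
    by (intro cSUP_least) (auto simp: s_def[symmetric] field_simps)
  then have "s \<le> 0" using C_nonneg by (simp add: field_simps)
  then show ?thesis using le_s[OF assms] laplace_lim_bounds(1)[of x] by linarith
qed

lemma nn_integral_exp_jump_time: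
  "(\<integral>\<^sup>+\<omega>. ennreal (exp (- (C + 1) * jump_time x \<omega> n)) \<partial>Om) = ennreal (laplace n x)"
proof (induction n arbitrary: x)
  case 0
  show ?case using Om.emeasure_space_1 by simp
next
  case (Suc n)
  let ?l = "C + 1" and ?c = "q x / (q x + (C + 1))"
  have l: "0 < q x + ?l" using rate_pos .
  interpret X: prob_space "density lborel (exponential_density (q x + ?l))"
    using l by (rule prob_space_exponential_density)
  \<comment> \<open>Exponential tilting: discounting a density of rate \<open>q x\<close> at rate
    \<open>?l\<close> gives \<open>?c\<close> times the density of rate
    \<open>q x + ?l\<close>.\<close>
  have e: "(\<integral>\<^sup>+s. ennreal (exponential_density (q x) s) * (ennreal (exp (- ?l * s)) * b) \<partial>lborel) = ennreal ?c * b" for b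
  proof -
    have "(\<integral>\<^sup>+s. ennreal (exponential_density (q x) s) * (ennreal (exp (- ?l * s)) * b) \<partial>lborel) =
      (\<integral>\<^sup>+s. (ennreal ?c * b) * ennreal (exponential_density (q x + ?l) s) \<partial>lborel)"
    proof (rule nn_integral_cong)
      fix s
      have "exponential_density (q x) s * exp (- ?l * s) = ?c * exponential_density (q x + ?l) s"
      proof -
        have "exp (- s * q x) * exp (- ?l * s) = exp (- s * (q x + ?l))"
          by (simp add: exp_add[symmetric] algebra_simps)
        moreover have "?c * ((q x + ?l) * b) = q x * b" for b
          using l by simp
        ultimately show ?thesis by (simp add: exponential_density_def mult.assoc)
      qed
      then have "ennreal (exponential_density (q x) s) * ennreal (exp (- ?l * s)) =
          ennreal ?c * ennreal (exponential_density (q x + ?l) s)"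
        using l by (simp add: exponential_density_nonneg flip: ennreal_mult)
      then show "ennreal (exponential_density (q x) s) * (ennreal (exp (- ?l * s)) * b) =
          (ennreal ?c * b) * ennreal (exponential_density (q x + ?l) s)"
        by (metis mult.assoc mult.commute)
    qed
    also have "\<dots> = (ennreal ?c * b) * (\<integral>\<^sup>+s. ennreal (exponential_density (q x + ?l) s) \<partial>lborel)"
      by (intro nn_integral_cmult) simp
    also have "(\<integral>\<^sup>+s. ennreal (exponential_density (q x + ?l) s) \<partial>lborel) = 1"
      using X.emeasure_space_1 by (simp add: emeasure_density)
    finally show ?thesis by simp
  qed
  have m: "(\<lambda>z. ennreal (exp (- ?l * snd z)) * ennreal (laplace n (fst z)))
      \<in> borel_measurable (count_space UNIV \<Otimes>\<^sub>M borel)"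
    by measurable
  have "(\<integral>\<^sup>+\<omega>. ennreal (exp (- ?l * jump_time x \<omega> (Suc n))) \<partial>Om) =
      (\<integral>\<^sup>+a. (\<integral>\<^sup>+\<omega>. ennreal (exp (- ?l * snd (a x))) * ennreal (exp (- ?l * jump_time (fst (a x)) \<omega> n)) \<partial>Om) \<partial>tables)"
    by (subst nn_integral_first_step, measurable)
       (simp only: jump_time_Stream distrib_left exp_add ennreal_mult exp_ge_zero)
  also have "\<dots> = (\<integral>\<^sup>+a. ennreal (exp (- ?l * snd (a x))) * ennreal (laplace n (fst (a x))) \<partial>tables)"
    by (subst nn_integral_cmult, measurable) (simp only: Suc)
  also have "\<dots> = (\<integral>\<^sup>+y. ennreal ?c * ennreal (laplace n y) \<partial>p x)"
    using nn_integral_table[OF m, of x] by (simp only: fst_conv snd_conv e)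
  also have "\<dots> = ennreal ?c * ennreal (measure_pmf.expectation (p x) (laplace n))"
    using laplace_bounds by (subst nn_integral_cmult) (auto simp: nn_integral_eq_integral[OF integrable_laplace])
  also have "\<dots> = ennreal (laplace (Suc n) x)"
    using laplace_bounds l by (subst ennreal_mult[symmetric]) (auto intro: integral_nonneg_AE)
  finally show ?case .
qed

text \<open>A Chernoff bound: if all jump times stay below \<open>t\<close>, then
  \<open>exp ((C + 1) * t)\<close> times the discount factor at the \<open>n\<close>-th jump is at
  least 1 for every \<open>n\<close>, but its expectation tends to 0.\<close>

lemma no_explosion:
  assumes "x \<in> E" "0 \<le> t"
  shows "AE \<omega> in Om. \<exists>n. t < jump_time x \<omega> (Suc n)"
proof -
  let ?N = "{\<omega>. \<forall>n. jump_time x \<omega> (Suc n) \<le> t}"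
  have N: "?N \<in> sets Om"
  proof -
    have "Measurable.pred Om (\<lambda>\<omega>. \<forall>n. jump_time x \<omega> (Suc n) \<le> t)" by measurable
    then show ?thesis by (simp add: pred_def)
  qed
  have "emeasure Om ?N \<le> ennreal (exp ((C + 1) * t) * laplace (Suc n) x)" for n
  proof -
    have "emeasure Om ?N = (\<integral>\<^sup>+\<omega>. indicator ?N \<omega> \<partial>Om)" using N by simp
    also have "\<dots> \<le> (\<integral>\<^sup>+\<omega>. ennreal (exp ((C + 1) * t)) * ennreal (exp (- (C + 1) * jump_time x \<omega> (Suc n))) \<partial>Om)"
    proof (rule nn_integral_mono)
      fix \<omega>
      have "1 \<le> ennreal (exp ((C + 1) * t)) * ennreal (exp (- (C + 1) * jump_time x \<omega> (Suc n)))"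
        if "jump_time x \<omega> (Suc n) \<le> t"
      proof -
        have "0 \<le> (C + 1) * (t - jump_time x \<omega> (Suc n))" using that C_nonneg by simp
        then have "1 \<le> exp ((C + 1) * t) * exp (- (C + 1) * jump_time x \<omega> (Suc n))"
          by (simp add: exp_add[symmetric] algebra_simps)
        then show ?thesis by (subst ennreal_mult[symmetric]) (simp_all only: exp_ge_zero ennreal_1[symmetric] ennreal_leI)
      qed
      then show "indicator ?N \<omega> \<le> ennreal (exp ((C + 1) * t)) * ennreal (exp (- (C + 1) * jump_time x \<omega> (Suc n)))"
        by (auto simp: indicator_def)
    qed
    also have "\<dots> = ennreal (exp ((C + 1) * t)) * ennreal (laplace (Suc n) x)"
      by (subst nn_integral_cmult) (simp, simp only: nn_integral_exp_jump_time)
    also have "\<dots> = ennreal (exp ((C + 1) * t) * laplace (Suc n) x)"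
      using laplace_bounds[of "Suc n" x] by (subst ennreal_mult) (auto simp del: laplace.simps)
    finally show ?thesis .
  qed
  moreover have "(\<lambda>n. ennreal (exp ((C + 1) * t) * laplace (Suc n) x)) \<longlonglongrightarrow> ennreal (exp ((C + 1) * t) * 0)"
    using LIMSEQ_Suc[OF laplace_tendsto[of x]] laplace_lim_zero[OF assms(1)]
    by (intro tendsto_ennrealI tendsto_mult_left) simp
  ultimately have "emeasure Om ?N \<le> ennreal (exp ((C + 1) * t) * 0)"
    by (intro LIMSEQ_le_const) auto
  then have "?N \<in> null_sets Om" using N by (simp add: null_sets_def)
  then show ?thesis by (rule AE_I') (auto simp: not_less)
qed

subsection \<open>Positive recurrence\<close>

text \<open>The kernel of the jump chain is symmetric with respect to the weights \<open>W z * q z\<close>.\<close>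

lemma excursion_duality:
  fixes f h :: "'s \<Rightarrow> ennreal"
  shows "(\<integral>\<^sup>+z. ennreal (W z * q z) * f z * (\<integral>\<^sup>+y. h y \<partial>p z) \<partial>count_space UNIV) =
    (\<integral>\<^sup>+z. ennreal (W z * q z) * h z * (\<integral>\<^sup>+y. f y \<partial>p z) \<partial>count_space UNIV)"
proof -
  interpret pair_sigma_finite "count_space (UNIV :: 's set)" "count_space (UNIV :: 's set)"
    by (intro pair_sigma_finite.intro sigma_finite_measure_count_space)
  have "(\<integral>\<^sup>+z. ennreal (W z * q z) * f z * (\<integral>\<^sup>+y. h y \<partial>p z) \<partial>count_space UNIV) =
      (\<integral>\<^sup>+z. (\<integral>\<^sup>+y. ennreal (W z * (q z * pmf (p z) y)) * f z * h y \<partial>count_space UNIV) \<partial>count_space UNIV)" for f h :: "'s \<Rightarrow> ennreal"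
    by (intro nn_integral_cong, subst nn_integral_measure_pmf, subst nn_integral_cmult[symmetric], simp)
       (intro nn_integral_cong, simp add: ennreal_mult mult_ac)
  note exp = this
  show ?thesis
    unfolding exp
    by (subst Fubini') (auto simp: balance mult_ac intro!: measurable_pair_measure_countable1)
qed

text \<open>Each use of duality moves one step of the kernel from \<open>excursion\<close> to
  \<open>first_hit\<close>, reversing the path jump by jump. After \<open>n\<close> moves only the
  mean holding time \<open>1 / q z\<close> is left of the excursion, and it cancels
  \<open>q z\<close>.\<close>

lemma excursion_first_hit:
  "(\<integral>\<^sup>+z. ennreal (W z * q z) * (indicator (- {x0}) z * first_hit x0 k z) * excursion x0 n z \<partial>count_space UNIV) =
   (\<integral>\<^sup>+z. ennreal (W z) * (indicator (- {x0}) z * first_hit x0 (k + n) z) \<partial>count_space UNIV)"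
proof (induction n arbitrary: k)
  case 0
  have "ennreal (W z * q z) * b * ennreal (1 / q z) = ennreal (W z) * b" for z b
  proof -
    have "ennreal (W z * q z) * ennreal (1 / q z) = ennreal (W z)"
      by (subst ennreal_mult[symmetric]) (auto simp: less_imp_neq[OF q_pos, symmetric])
    then show ?thesis by (metis mult.assoc mult.commute)
  qed
  then show ?case by simp
next
  case (Suc n)
  have "(\<integral>\<^sup>+z. ennreal (W z * q z) * (indicator (- {x0}) z * first_hit x0 k z) * excursion x0 (Suc n) z \<partial>count_space UNIV) =
     (\<integral>\<^sup>+z. ennreal (W z * q z) * (indicator (- {x0}) z * excursion x0 n z) * first_hit x0 (Suc k) z \<partial>count_space UNIV)"
    unfolding excursion.simps first_hit.simps by (rule excursion_duality)
  also have "\<dots> = (\<integral>\<^sup>+z. ennreal (W z) * (indicator (- {x0}) z * first_hit x0 (Suc k + n) z) \<partial>count_space UNIV)"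
    unfolding Suc[symmetric] by (simp only: mult_ac)
  finally show ?case by simp
qed

text \<open>Multiplied by \<open>W x0 * q x0\<close>, term \<open>n + 1\<close> becomes the
  \<open>W\<close>-average over \<open>z \<noteq> x0\<close> of the probability of first hitting
  \<open>x0\<close> after \<open>n + 1\<close> jumps. These probabilities sum to at most 1 over
  \<open>n\<close>, so the total is bounded by the mass of \<open>W\<close>. The term for
  \<open>n = 0\<close> is the holding time in \<open>x0\<close>.\<close>

lemma excursion_sum_finite:
  assumes x0: "x0 \<in> E"
  shows "(\<Sum>n. excursion x0 n x0) < \<infinity>"
proof -
  have W1: "(\<integral>\<^sup>+z. ennreal (W z) \<partial>count_space UNIV) = 1"
  proof -
    have "(W has_sum 1) UNIV"
      using W_sum W_zero by (subst has_sum_cong_neutral[where T=E and g=W]) auto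
    then show ?thesis by (subst (asm) has_sum_nn_integral_count_space) auto
  qed
  have e: "ennreal (W x0 * q x0) * excursion x0 (Suc n) x0 =
      (\<integral>\<^sup>+z. ennreal (W z) * (indicator (- {x0}) z * first_hit x0 n z) \<partial>count_space UNIV)" for n
  proof -
    have "ennreal (W x0 * q x0) * excursion x0 (Suc n) x0 =
       (\<integral>\<^sup>+y. ennreal (W x0 * (q x0 * pmf (p x0) y)) * (indicator (- {x0}) y * excursion x0 n y) \<partial>count_space UNIV)"
      unfolding excursion.simps
      by (subst nn_integral_measure_pmf, subst nn_integral_cmult[symmetric], simp)
         (intro nn_integral_cong, simp add: ennreal_mult mult_ac)
    also have "\<dots> = (\<integral>\<^sup>+y. ennreal (W y * q y) * (indicator (- {x0}) y * first_hit x0 0 y) * excursion x0 n y \<partial>count_space UNIV)"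
      by (intro nn_integral_cong) (simp add: balance[of x0] ennreal_mult mult_ac)
    also have "\<dots> = (\<integral>\<^sup>+z. ennreal (W z) * (indicator (- {x0}) z * first_hit x0 (0 + n) z) \<partial>count_space UNIV)"
      by (rule excursion_first_hit)
    finally show ?thesis by simp
  qed
  have "(\<Sum>n<N. ennreal (W x0 * q x0) * excursion x0 (Suc n) x0) \<le> 1" for N
  proof -
    have "(\<Sum>n<N. ennreal (W x0 * q x0) * excursion x0 (Suc n) x0) =
        (\<integral>\<^sup>+z. ennreal (W z) * (indicator (- {x0}) z * (\<Sum>n<N. first_hit x0 n z)) \<partial>count_space UNIV)"
      unfolding e by (subst nn_integral_sum[symmetric]) (simp, simp only: sum_distrib_left)
    also have "\<dots> \<le> (\<integral>\<^sup>+z. ennreal (W z) \<partial>count_space UNIV)"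
    proof (rule nn_integral_mono)
      fix z
      have "indicator (- {x0}) z * (\<Sum>n<N. first_hit x0 n z) \<le> 1 * (1 :: ennreal)"
        by (intro mult_mono sum_first_hit_le_1) (auto simp: indicator_def)
      then show "ennreal (W z) * (indicator (- {x0}) z * (\<Sum>n<N. first_hit x0 n z)) \<le> ennreal (W z)"
        using mult_left_mono[of _ 1 "ennreal (W z)"] by simp
    qed
    finally show ?thesis using W1 by simp
  qed
  then have "(\<Sum>n. ennreal (W x0 * q x0) * excursion x0 (Suc n) x0) \<le> 1"
    by (intro suminf_le_const) auto
  then have "ennreal (W x0 * q x0) * (\<Sum>n. excursion x0 (Suc n) x0) \<le> 1"
    by (simp only: ennreal_suminf_cmult)
  moreover have "0 < W x0 * q x0" using W_pos[OF x0] by simp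
  then have nz: "ennreal (W x0 * q x0) \<noteq> 0"
    by (simp only: ennreal_eq_0_iff not_le)
  ultimately have "(\<Sum>n. excursion x0 (Suc n) x0) < top"
    using nz by (metis ennreal_mult_top ennreal_one_less_top leD top.not_eq_extremum)
  moreover have "(\<Sum>n. excursion x0 n x0) = excursion x0 0 x0 + (\<Sum>n. excursion x0 (Suc n) x0)"
    by (subst suminf_offset[where i=1]) (auto simp: add.commute)
  ultimately show ?thesis by simp
qed

text \<open>If the chain returns, the terms before the return add up to the time of return. If it
  never does, the sum is infinite because the jump times are unbounded. Almost sure return is thus a
  consequence of the finite expectation, not an input.\<close>

lemma return_time_le:
  fixes x :: 's
  assumes pos: "\<forall>n. 0 < holding_time x \<omega> n" and unbounded: "\<forall>k::nat. \<exists>n. real k < jump_time x \<omega> (Suc n)"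
  shows "return_time x \<omega> \<le> (\<Sum>n. ennreal (holding_time x \<omega> n) * indicator {\<omega>. \<forall>m<n. jump_chain x \<omega> (Suc m) \<noteq> x} \<omega>)"
    (is "_ \<le> (\<Sum>n. ?f n)")
proof -
  have jt: "(\<Sum>n<k. ennreal (holding_time x \<omega> n)) = ennreal (jump_time x \<omega> k)" for k
    unfolding jump_time_def using pos by (subst sum_ennreal) (auto intro: less_imp_le)
  have mono: "jump_time x \<omega> i \<le> jump_time x \<omega> j" if "i \<le> j" for i j
    unfolding jump_time_def using pos that by (intro sum_mono2) (auto intro: less_imp_le)
  show ?thesis
  proof (cases "\<exists>m. jump_chain x \<omega> (Suc m) = x")
    case True
    define s where "s = (LEAST m. jump_chain x \<omega> (Suc m) = x)"
    have s: "jump_chain x \<omega> (Suc s) = x" "\<And>m. m < s \<Longrightarrow> jump_chain x \<omega> (Suc m) \<noteq> x"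
      unfolding s_def by (rule LeastI_ex[OF True], rule not_less_Least)
    \<comment> \<open>Positivity of the following holding time ensures that the process is in
      \<open>x\<close> at the jump time itself.\<close>
    have "jump_time x \<omega> (Suc s) < jump_time x \<omega> (Suc (Suc s))"
      using pos by (simp add: jump_time_def)
    then have "visit x \<omega> (jump_time x \<omega> (Suc s)) (Suc s) x"
      unfolding visit_def using s(1) by (intro conjI allI impI mono) simp_all
    then have "process x \<omega> (jump_time x \<omega> (Suc s)) = Some x"
      unfolding process_eq_Some_iff by blast
    moreover have "jump_time x \<omega> 1 \<le> jump_time x \<omega> (Suc s)" by (rule mono) simp
    ultimately have "return_time x \<omega> \<le> ennreal (jump_time x \<omega> (Suc s))"
      unfolding return_time_def by (intro Inf_lower) blast
    also have "\<dots> = (\<Sum>n<Suc s. ?f n)"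
      unfolding jt[symmetric] by (intro sum.cong) (auto simp: s(2))
    also have "\<dots> \<le> (\<Sum>n. ?f n)"
      by (intro sum_le_suminf) auto
    finally show ?thesis .
  next
    case False
    have "ennreal (real k) \<le> (\<Sum>n. ?f n)" for k
    proof -
      obtain n where "real k < jump_time x \<omega> (Suc n)" using unbounded by blast
      have "ennreal (real k) \<le> (\<Sum>n<Suc n. ?f n)"
      proof -
        have "(\<Sum>n<Suc n. ?f n) = ennreal (jump_time x \<omega> (Suc n))"
          unfolding jt[symmetric] using False by (intro sum.cong) simp_all
        then show ?thesis using \<open>real k < jump_time x \<omega> (Suc n)\<close> by (simp only: ennreal_leI less_imp_le)
      qed
      also have "\<dots> \<le> (\<Sum>n. ?f n)" by (intro sum_le_suminf) auto
      finally show ?thesis .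
    qed
    then have "\<not> (\<Sum>n. ?f n) < of_nat k" for k
      by (simp only: ennreal_of_nat_eq_real_of_nat not_less)
    then have "\<not> (\<Sum>n. ?f n) < top"
      using ennreal_Ex_less_of_nat by blast
    then have "(\<Sum>n. ?f n) = top" by (simp only: less_top[symmetric] not_not)
    then show ?thesis by (simp only: top_greatest)
  qed
qed

lemma positive_recurrent: "positive_recurrent E Q"
  unfolding positive_recurrent_def
proof
  fix x assume x: "x \<in> E"
  let ?f = "\<lambda>n \<omega>. ennreal (holding_time x \<omega> n) * indicator {\<omega>. \<forall>m<n. jump_chain x \<omega> (Suc m) \<noteq> x} \<omega>"
  have [measurable]: "{\<omega>. \<forall>m<n. jump_chain x \<omega> (Suc m) \<noteq> x} \<in> sets Om" for n
  proof -
    have "Measurable.pred Om (\<lambda>\<omega>. \<forall>m<n. jump_chain x \<omega> (Suc m) \<noteq> x)" by measurable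
    then show ?thesis by (simp add: pred_def)
  qed
  have "AE \<omega> in Om. \<forall>k::nat. \<exists>n. real k < jump_time x \<omega> (Suc n)"
    using no_explosion[OF x] by (simp add: AE_all_countable)
  then have "AE \<omega> in Om. return_time x \<omega> \<le> (\<Sum>n. ?f n \<omega>)"
    using AE_holding_time_pos[of x] by eventually_elim (rule return_time_le)
  then have "(\<integral>\<^sup>+\<omega>. return_time x \<omega> \<partial>Om) \<le> (\<integral>\<^sup>+\<omega>. (\<Sum>n. ?f n \<omega>) \<partial>Om)"
    by (rule nn_integral_mono_AE)
  also have "\<dots> = (\<Sum>n. excursion x n x)"
    by (subst nn_integral_suminf, measurable) (simp only: nn_integral_holding_time)
  also have "\<dots> < \<infinity>" by (rule excursion_sum_finite[OF x])
  finally show "(\<integral>\<^sup>+\<omega>. return_time x \<omega> \<partial>Om) < \<infinity>" .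
qed

subsection \<open>Stationarity and reversibility\<close>

lemma trans_prob_balance: "0 \<le> t \<Longrightarrow> W x * trans_prob t x z = W z * trans_prob t z x"
  by (rule trans_prob_symmetric[OF W_nonneg balance])

lemma trans_prob_has_sum:
  assumes x: "x \<in> E" and t: "0 \<le> t"
  shows "(trans_prob t x has_sum 1) E"
proof -
  \<comment> \<open>Balance also confines the process to \<open>E\<close>, since
    \<open>W z = 0\<close> while \<open>W x > 0\<close>.\<close>
  have zero: "trans_prob t x z = 0" if "z \<notin> E" for z
    using trans_prob_balance[OF t, of x z] W_pos[OF x] W_zero[OF that] by simp
  have "AE \<omega> in Om. \<omega> \<in> (\<Union>z. {\<omega>. process x \<omega> t = Some z})"
    using no_explosion[OF x t]
  proof eventually_elim
    case (elim \<omega>)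
    then have "process x \<omega> t \<noteq> None"
      unfolding process_eq_None_iff by (meson leD)
    then show ?case by auto
  qed
  moreover have [measurable]: "{\<omega>. process x \<omega> t = Some z} \<in> sets Om" for z
  proof -
    have "Measurable.pred Om (\<lambda>\<omega>. process x \<omega> t = Some z)" by measurable
    then show ?thesis by (simp add: pred_def)
  qed
  ultimately have "1 = emeasure Om (\<Union>z. {\<omega>. process x \<omega> t = Some z})"
    by (subst Om.emeasure_eq_1_AE) auto
  also have "\<dots> = (\<integral>\<^sup>+z. ennreal (trans_prob t x z) \<partial>count_space UNIV)"
    by (subst emeasure_UN_countable) (auto simp: disjoint_family_on_def emeasure_process)
  finally have "(trans_prob t x has_sum 1) UNIV"
    by (subst has_sum_nn_integral_count_space) auto
  then show ?thesis
    using zero by (subst has_sum_cong_neutral[where T=UNIV and g="trans_prob t x"]) auto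
qed

lemma fin_dim_prob_single: "fin_dim_prob E Q \<mu> {(t, z)} = (\<Sum>\<^sub>\<infinity>x\<in>E. \<mu> x * trans_prob t x z)"
  by (simp add: fin_dim_prob_def trans_prob_def)

text \<open>Balance turns the sum over starting states into \<open>W z\<close> times the total mass
  of \<open>trans_prob t z\<close>, which is 1 by non-explosion.\<close>

lemma W_stationary:
  assumes "z \<in> E" "0 \<le> t"
  shows "((\<lambda>x. W x * trans_prob t x z) has_sum W z) E"
  using has_sum_cmult_right[OF trans_prob_has_sum[OF assms], of "W z"]
  by (simp add: trans_prob_balance[OF assms(2), of _ z])

lemma stationary: "stationary_distribution E Q W"
  unfolding stationary_distribution_def prob_distribution_def fin_dim_prob_single
  using W_sum W_stationary by (auto intro: infsumI)

lemma fin_dim_prob_chain: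
  assumes t: "0 \<le> t 0" "\<And>i. i < m \<Longrightarrow> t i \<le> t (Suc i)" and z: "z 0 \<in> E"
  shows "fin_dim_prob E Q W ((\<lambda>i. (t i, z i)) ` {..m}) =
    W (z 0) * (\<Prod>i<m. trans_prob (t (Suc i) - t i) (z i) (z (Suc i)))"
proof -
  have "fin_dim_prob E Q W ((\<lambda>i. (t i, z i)) ` {..m}) =
      (\<Sum>\<^sub>\<infinity>x\<in>E. W x * trans_prob (t 0) x (z 0) * (\<Prod>i<m. trans_prob (t (Suc i) - t i) (z i) (z (Suc i))))"
  proof -
    have "(\<forall>(s, w)\<in>(\<lambda>i. (t i, z i)) ` {..m}. process x \<omega> s = Some w) \<longleftrightarrow>
        (\<forall>i\<le>m. process x \<omega> (t i) = Some (z i))" for x \<omega>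
      by auto
    then show ?thesis
      unfolding fin_dim_prob_def by (simp only: fin_dim_trans[of t m _ z, OF t] space_Om UNIV_I simp_thms mult.assoc)
  qed
  also have "\<dots> = (\<Sum>\<^sub>\<infinity>x\<in>E. W x * trans_prob (t 0) x (z 0)) * (\<Prod>i<m. trans_prob (t (Suc i) - t i) (z i) (z (Suc i)))"
    by (rule infsum_cmult_left')
  also have "(\<Sum>\<^sub>\<infinity>x\<in>E. W x * trans_prob (t 0) x (z 0)) = W (z 0)"
    using W_stationary[OF z t(1)] by (rule infsumI)
  finally show ?thesis .
qed

lemma W_chain_reverse:
  assumes "\<And>i. i < m \<Longrightarrow> 0 \<le> d i"
  shows "W (z 0) * (\<Prod>i<m. trans_prob (d i) (z i) (z (Suc i))) = W (z m) * (\<Prod>i<m. trans_prob (d i) (z (Suc i)) (z i))"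
  using assms
proof (induction m)
  case (Suc m)
  then have "W (z 0) * (\<Prod>i<Suc m. trans_prob (d i) (z i) (z (Suc i))) =
      (W (z m) * trans_prob (d m) (z m) (z (Suc m))) * (\<Prod>i<m. trans_prob (d i) (z (Suc i)) (z i))"
    by (simp add: mult_ac)
  also have "W (z m) * trans_prob (d m) (z m) (z (Suc m)) = W (z (Suc m)) * trans_prob (d m) (z (Suc m)) (z m)"
    using Suc.prems by (intro trans_prob_balance) auto
  finally show ?case by (simp add: mult_ac)
qed simp

lemma reversible: "reversible E Q W"
  unfolding reversible_def
proof (intro allI impI)
  fix T :: real and A :: "(real \<times> 's) set"
  assume T: "0 \<le> T" and A: "finite A" "A \<subseteq> {0..T} \<times> E"
  show "fin_dim_prob E Q W ((\<lambda>(t, z). (T - t, z)) ` A) = fin_dim_prob E Q W A"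
  proof (cases "A = {}")
    case True
    then show ?thesis by simp
  next
    case False
    obtain xs where xs: "set xs = A" using finite_list[OF A(1)] by blast
    \<comment> \<open>Ties in time may remain, since \<open>A\<close> may contain several states for
      one time; they contribute factors \<open>trans_prob 0\<close>, which the chain formula
      allows.\<close>
    define ys where "ys = sort_key fst xs"
    have ys: "set ys = A" "sorted (map fst ys)" by (simp_all add: ys_def xs)
    then have "ys \<noteq> []" using False by auto
    define m where "m = length ys - 1"
    define t z where "t i = fst (ys ! i)" and "z i = snd (ys ! i)" for i
    have len: "length ys = Suc m" using \<open>ys \<noteq> []\<close> by (simp add: m_def)
    have A_eq: "A = (\<lambda>i. (t i, z i)) ` {..m}"
      unfolding ys(1)[symmetric] set_conv_nth t_def z_def len by (auto simp: less_Suc_eq_le)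
    have mono: "t i \<le> t (Suc i)" if "i < m" for i
      using sorted_nth_mono[OF ys(2), of i "Suc i"] that len by (simp add: t_def)
    have tz: "0 \<le> t i" "t i \<le> T" "z i \<in> E" if "i \<le> m" for i
      using A(2) A_eq that by auto
    \<comment> \<open>Reversing the indices as well makes the reflected times increase
      again.\<close>
    let ?t = "\<lambda>i. T - t (m - i)" and ?z = "\<lambda>i. z (m - i)"
    have rev: "(\<lambda>(t, z). (T - t, z)) ` A = (\<lambda>i. (?t i, ?z i)) ` {..m}"
    proof -
      have "(\<lambda>i. m - i) ` {..m} = {..m}"
      proof safe
        show "x \<in> (\<lambda>i. m - i) ` {..m}" if "x \<le> m" for x
          by (rule image_eqI[of _ _ "m - x"]) (use that in auto)
      qed auto
      then have "(\<lambda>i. (?t i, ?z i)) ` {..m} = (\<lambda>i. (T - t i, z i)) ` {..m}"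
        by (metis (no_types, lifting) image_cong image_image)
      then show ?thesis unfolding A_eq by (simp add: image_image)
    qed
    have mono': "?t i \<le> ?t (Suc i)" if "i < m" for i
      using mono[of "m - Suc i"] that by (simp add: Suc_diff_Suc)
    have "fin_dim_prob E Q W ((\<lambda>(t, z). (T - t, z)) ` A) =
        W (?z 0) * (\<Prod>i<m. trans_prob (?t (Suc i) - ?t i) (?z i) (?z (Suc i)))"
      unfolding rev by (rule fin_dim_prob_chain[of ?t m ?z, OF _ mono']) (use tz in auto)
    also have "(\<Prod>i<m. trans_prob (?t (Suc i) - ?t i) (?z i) (?z (Suc i))) =
        (\<Prod>i<m. trans_prob (t (Suc i) - t i) (z (Suc i)) (z i))"
      by (subst prod.nat_diff_reindex[symmetric]) (auto intro!: prod.cong simp: Suc_diff_Suc)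
    also have "W (?z 0) * \<dots> = W (z 0) * (\<Prod>i<m. trans_prob (t (Suc i) - t i) (z i) (z (Suc i)))"
      using mono by (simp add: W_chain_reverse[of m "\<lambda>i. t (Suc i) - t i" z])
    also have "\<dots> = fin_dim_prob E Q W A"
      unfolding A_eq by (rule fin_dim_prob_chain[of t m z, symmetric, OF _ mono]) (use tz in auto)
    finally show ?thesis .
  qed
qed

section \<open>Positivity of the transition probabilities and uniqueness\<close>

lemma jump_trans_pos_step:
  assumes y: "0 < pmf (p x) y" and pos: "\<And>t. 0 < t \<Longrightarrow> 0 < jump_trans n t y z" and t: "0 < t"
  shows "0 < jump_trans (Suc n) t x z"
proof (rule ccontr)
  let ?f = "\<lambda>w. jump_rate x (fst w) * stay x (snd w) * jump_trans n (t - snd w) (fst w) z"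
  assume "\<not> 0 < jump_trans (Suc n) t x z"
  then have "(\<integral>\<^sup>+w. ?f w \<partial>steps) = 0" by (simp add: case_prod_beta')
  then have "AE w in steps. ?f w = 0"
    by (subst (asm) nn_integral_0_iff_AE) auto
  \<comment> \<open>A jump to \<open>y\<close> at any moment before \<open>t\<close> leaves time for
    the remaining path, so the integrand is positive on a set of measure \<open>t\<close>.\<close>
  then have "AE w in steps. w \<notin> {y} \<times> {0<..<t}"
  proof eventually_elim
    case (elim w)
    have "q x \<noteq> 0" by (metis less_irrefl q_pos)
    then have "?f w \<noteq> 0" if "w \<in> {y} \<times> {0<..<t}"
      using that y pos[of "t - snd w"] by (auto simp: stay_def)
    then show ?case using elim by auto
  qed
  then have "emeasure steps ({y} \<times> {0<..<t}) = 0"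
    by (subst (asm) AE_iff_measurable[OF _ refl]) (auto simp: space_pair_measure)
  moreover have "emeasure steps ({y} \<times> {0<..<t}) = ennreal t"
    using t by (subst lborel.emeasure_pair_measure_Times) auto
  ultimately show False using t by simp
qed

text \<open>The length of a path of the jump chain serves as the number of jumps for all times at
  once, so one time step suffices to reach every state of \<open>E\<close>; uniqueness uses this at
  time 1.\<close>

lemma trans_prob_pos:
  assumes "x \<in> E" "z \<in> E" and t: "0 < t"
  shows "0 < trans_prob t x z"
proof -
  have "\<exists>n. \<forall>t>0. 0 < jump_trans n t x z"
    using irreducible[OF assms(1,2)]
  proof (induction rule: converse_rtrancl_induct)
    case base
    have "\<forall>t>0. 0 < jump_trans 0 t z z" by (simp add: stay_def)
    then show ?case by blast
  next
    case (step x y)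
    then show ?case using jump_trans_pos_step by blast
  qed
  then obtain n where n: "0 < jump_trans n t x z" using t by blast
  also have "jump_trans n t x z \<le> (\<Sum>n. jump_trans n t x z)"
    using sum_le_suminf[of "\<lambda>n. jump_trans n t x z" "{n}"] by simp
  also have "\<dots> = ennreal (trans_prob t x z)" using emeasure_process_sum[of t x z] t by simp
  finally show ?thesis by simp
qed

text \<open>
  If \<open>\<mu>\<close> differs from \<open>W\<close>, then \<open>\<mu> a > W a\<close> and \<open>\<mu> b < W b\<close> for some \<open>a\<close>, \<open>b\<close>. The mass of
  \<open>min \<mu> W\<close> is preserved by a transition, which however maps \<open>min \<mu> W\<close> to something at most
  \<open>min \<mu> W\<close> that is strictly smaller at \<open>b\<close>, because the excess of \<open>\<mu>\<close> at \<open>a\<close> reaches \<open>b\<close>.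
\<close>

lemma stationary_unique:
  assumes "stationary_distribution E Q \<mu>" "x \<in> E"
  shows "\<mu> x = W x"
proof -
  have \<mu>: "0 \<le> \<mu> x" if "x \<in> E" for x
    using assms(1) that unfolding stationary_distribution_def prob_distribution_def by auto
  have inv: "(\<Sum>\<^sub>\<infinity>x\<in>E. \<mu> x * trans_prob 1 x z) = \<mu> z" if "z \<in> E" for z
    using assms(1) that unfolding stationary_distribution_def fin_dim_prob_single by auto
  have \<mu>_sum: "(\<mu> has_sum 1) E"
    using assms(1) unfolding stationary_distribution_def prob_distribution_def by auto
  \<comment> \<open>An equation for \<open>infsum\<close> does not give convergence, as the sum
    defaults to 0 otherwise; summability comes from comparison with \<open>\<mu>\<close>.\<close>
  have inv_sum: "((\<lambda>x. \<mu> x * trans_prob 1 x z) has_sum \<mu> z) E" if "z \<in> E" for z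
  proof -
    have "(\<lambda>x. \<mu> x * trans_prob 1 x z) summable_on E"
    proof (rule summable_on_comparison_test)
      show "\<mu> summable_on E" using \<mu>_sum by (auto simp: summable_on_def)
      show "\<mu> x * trans_prob 1 x z \<le> \<mu> x" if "x \<in> E" for x
        using \<mu>[OF that] by (simp add: mult_left_le trans_prob_le_1)
    qed (use \<mu> in auto)
    then show ?thesis using inv[OF that] has_sum_infsum by fastforce
  qed
  let ?m = "\<lambda>x. min (\<mu> x) (W x)"
  have m_nonneg: "0 \<le> ?m x" if "x \<in> E" for x using \<mu>[OF that] by simp
  have le: "\<mu> x \<le> W x" if x: "x \<in> E" for x
  proof (rule ccontr)
    assume a: "\<not> \<mu> x \<le> W x"
    \<comment> \<open>Both distributions have mass 1, so an excess at \<open>x\<close> forces a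
      deficit elsewhere.\<close>
    obtain b where b: "b \<in> E" "\<mu> b < W b"
    proof (rule ccontr)
      assume "\<not> thesis"
      then have "\<And>b. b \<in> E \<Longrightarrow> W b \<le> \<mu> b" using that by force
      then have "(1::real) < 1"
        using has_sum_strict_mono[OF W_sum \<mu>_sum _ x] a by auto
      then show False by simp
    qed
    define c where "c = (\<mu> x - W x) * trans_prob 1 x b"
    have c: "0 < c" unfolding c_def using a trans_prob_pos[OF x b(1), of 1] by simp
    have e: "(\<integral>\<^sup>+y. ennreal (?m y * trans_prob 1 y z) \<partial>count_space E) + ennreal (if z = b then c else 0) \<le> ennreal (?m z)"
      if z: "z \<in> E" for z
    proof -
      have leW: "(\<integral>\<^sup>+y. ennreal (?m y * trans_prob 1 y z) \<partial>count_space E) \<le> ennreal (W z)"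
      proof -
        have "(\<integral>\<^sup>+y. ennreal (?m y * trans_prob 1 y z) \<partial>count_space E) \<le> (\<integral>\<^sup>+y. ennreal (W y * trans_prob 1 y z) \<partial>count_space E)"
          by (intro nn_integral_mono ennreal_leI mult_right_mono) auto
        also have "\<dots> = ennreal (W z)"
          using W_stationary[OF z zero_le_one] by (subst (asm) has_sum_nn_integral_count_space) auto
        finally show ?thesis .
      qed
      have le\<mu>: "(\<integral>\<^sup>+y. ennreal (?m y * trans_prob 1 y z) \<partial>count_space E) + ennreal ((\<mu> x - W x) * trans_prob 1 x z) \<le> ennreal (\<mu> z)"
      proof -
        have "(\<integral>\<^sup>+y. ennreal (?m y * trans_prob 1 y z) \<partial>count_space E) + ennreal ((\<mu> x - W x) * trans_prob 1 x z) =
            (\<integral>\<^sup>+y. ennreal (?m y * trans_prob 1 y z) + ennreal ((\<mu> x - W x) * trans_prob 1 x z) * indicator {x} y \<partial>count_space E)"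
          using x by (subst nn_integral_add) (auto simp: nn_integral_cmult_indicator one_ennreal_def[symmetric])
        also have "\<dots> \<le> (\<integral>\<^sup>+y. ennreal (\<mu> y * trans_prob 1 y z) \<partial>count_space E)"
        proof (rule nn_integral_mono)
          fix y assume "y \<in> space (count_space E)"
          then have y: "y \<in> E" by simp
          have "?m y * trans_prob 1 y z + (if y = x then (\<mu> x - W x) * trans_prob 1 x z else 0) \<le> \<mu> y * trans_prob 1 y z"
            using a by (auto simp: left_diff_distrib intro: mult_right_mono)
          then show "ennreal (?m y * trans_prob 1 y z) + ennreal ((\<mu> x - W x) * trans_prob 1 x z) * indicator {x} y \<le> ennreal (\<mu> y * trans_prob 1 y z)"
            using a m_nonneg[OF y] by (cases "y = x") (auto simp flip: ennreal_plus intro!: ennreal_leI)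
        qed
        also have "\<dots> = ennreal (\<mu> z)"
          using inv_sum[OF z] \<mu> z by (subst (asm) has_sum_nn_integral_count_space) auto
        finally show ?thesis .
      qed
      have le0: "(\<integral>\<^sup>+y. ennreal (?m y * trans_prob 1 y z) \<partial>count_space E) \<le> ennreal (\<mu> z)"
        using le\<mu> by (rule order.trans[rotated]) simp
      show ?thesis
      \<comment> \<open>At \<open>b\<close> the minimum is \<open>\<mu> b\<close>, and the bound by
        \<open>\<mu>\<close> has room for the excess \<open>c\<close> arriving from
        \<open>x\<close>. Elsewhere the bounds by \<open>\<mu>\<close> and \<open>W\<close> are
        combined.\<close>
      proof (cases "z = b")
        case True
        then show ?thesis using le\<mu> b(2) by (simp add: c_def min_def)
      next
        case False
        then show ?thesis using leW le0 by (simp add: min_def)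
      qed
    qed
    interpret pair_sigma_finite "count_space E" "count_space E"
      by (intro pair_sigma_finite.intro sigma_finite_measure_count_space_countable) auto
    let ?M = "\<integral>\<^sup>+z. ennreal (?m z) \<partial>count_space E"
    have "?M + ennreal c = (\<integral>\<^sup>+y. ennreal (?m y) * (\<integral>\<^sup>+z. ennreal (trans_prob 1 y z) \<partial>count_space E) \<partial>count_space E) + ennreal c"
    proof -
      have "(\<integral>\<^sup>+z. ennreal (trans_prob 1 y z) \<partial>count_space E) = 1" if "y \<in> E" for y
        using trans_prob_has_sum[OF that zero_le_one] by (subst (asm) has_sum_nn_integral_count_space) auto
      then have "?M = (\<integral>\<^sup>+y. ennreal (?m y) * (\<integral>\<^sup>+z. ennreal (trans_prob 1 y z) \<partial>count_space E) \<partial>count_space E)"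
        by (intro nn_integral_cong) simp
      then show ?thesis by simp
    qed
    also have "\<dots> = (\<integral>\<^sup>+y. (\<integral>\<^sup>+z. ennreal (?m y * trans_prob 1 y z) \<partial>count_space E) \<partial>count_space E) + ennreal c"
    proof -
      have "(\<integral>\<^sup>+y. ennreal (?m y) * (\<integral>\<^sup>+z. ennreal (trans_prob 1 y z) \<partial>count_space E) \<partial>count_space E) =
          (\<integral>\<^sup>+y. (\<integral>\<^sup>+z. ennreal (?m y * trans_prob 1 y z) \<partial>count_space E) \<partial>count_space E)"
        by (intro nn_integral_cong, subst nn_integral_cmult[symmetric], simp)
           (intro nn_integral_cong, use m_nonneg in \<open>simp add: ennreal_mult\<close>)
      then show ?thesis by simp
    qed
    also have "\<dots> = (\<integral>\<^sup>+z. (\<integral>\<^sup>+y. ennreal (?m y * trans_prob 1 y z) \<partial>count_space E) \<partial>count_space E) +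
        (\<integral>\<^sup>+z. ennreal c * indicator {b} z \<partial>count_space E)"
    proof -
      have "(\<integral>\<^sup>+z. ennreal c * indicator {b} z \<partial>count_space E) = ennreal c"
        using b(1) by (subst nn_integral_cmult_indicator) auto
      moreover have "(\<lambda>(y, z). ennreal (?m y * trans_prob 1 y z)) \<in> borel_measurable (count_space E \<Otimes>\<^sub>M count_space E)"
        by (subst pair_measure_countable) auto
      from Fubini'[OF this] have "(\<integral>\<^sup>+y. (\<integral>\<^sup>+z. ennreal (?m y * trans_prob 1 y z) \<partial>count_space E) \<partial>count_space E) =
        (\<integral>\<^sup>+z. (\<integral>\<^sup>+y. ennreal (?m y * trans_prob 1 y z) \<partial>count_space E) \<partial>count_space E)" by simp
      ultimately show ?thesis by simp
    qed
    also have "\<dots> = (\<integral>\<^sup>+z. (\<integral>\<^sup>+y. ennreal (?m y * trans_prob 1 y z) \<partial>count_space E) + ennreal c * indicator {b} z \<partial>count_space E)"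
      by (subst nn_integral_add) auto
    also have "\<dots> \<le> ?M"
    proof (rule nn_integral_mono)
      fix z assume "z \<in> space (count_space E)"
      then show "(\<integral>\<^sup>+y. ennreal (?m y * trans_prob 1 y z) \<partial>count_space E) + ennreal c * indicator {b} z \<le> ennreal (?m z)"
        using e[of z] by (cases "z = b") auto
    qed
    finally have "?M + ennreal c \<le> ?M" .
    \<comment> \<open>Finiteness of \<open>?M\<close> is what allows it to be cancelled, leaving
      \<open>c \<le> 0\<close>.\<close>
    moreover have "?M \<le> 1"
    proof -
      have "?M \<le> (\<integral>\<^sup>+z. ennreal (W z) \<partial>count_space E)"
        by (intro nn_integral_mono ennreal_leI) auto
      also have "\<dots> = 1"
        using W_sum by (subst (asm) has_sum_nn_integral_count_space) auto
      finally show ?thesis .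
    qed
    then have "?M < top" by (rule order.strict_trans1) simp
    ultimately show False using c
      by (cases ?M) (simp_all flip: ennreal_plus)
  qed
  show ?thesis
  proof (rule antisym[OF le[OF assms(2)]], rule ccontr)
    assume "\<not> W x \<le> \<mu> x"
    then have "(1::real) < 1"
      using has_sum_strict_mono[OF \<mu>_sum W_sum le assms(2)] by simp
    then show False by simp
  qed
qed

lemma stationary_iff: "stationary_distribution E Q \<mu> \<longleftrightarrow> (\<forall>x\<in>E. \<mu> x = W x)"
proof
  assume "\<forall>x\<in>E. \<mu> x = W x"
  then have "prob_distribution E \<mu> = prob_distribution E W" "fin_dim_prob E Q \<mu> A = fin_dim_prob E Q W A" for A
    by (auto simp: prob_distribution_def fin_dim_prob_def intro!: has_sum_cong infsum_cong)
  then show "stationary_distribution E Q \<mu>"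
    using stationary \<open>\<forall>x\<in>E. \<mu> x = W x\<close> by (simp add: stationary_distribution_def)
qed (use stationary_unique in blast)

end

section \<open>The network\<close>

lemma move_simps:
  assumes "k \<noteq> l"
  shows "move k l n k = n k - 1" "move k l n l = n l + 1" "s \<noteq> k \<Longrightarrow> s \<noteq> l \<Longrightarrow> move k l n s = n s"
  using assms by (auto simp: move_def)

lemma move_back: "k \<noteq> l \<Longrightarrow> 1 \<le> n k \<Longrightarrow> move l k (move k l n) = n"
  by (auto simp: move_def fun_eq_iff)

lemma prod_split2:
  fixes f :: "'a::finite \<Rightarrow> 'b::comm_monoid_mult"
  assumes "k \<noteq> l"
  shows "prod f UNIV = f k * f l * prod f (UNIV - {k, l})"
  using assms prod.remove[of UNIV k f] prod.remove[of "UNIV - {k}" l f]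
  by (simp add: mult.assoc Diff_insert2[symmetric] insert_commute)

lemma sum_split2:
  fixes f :: "'a::finite \<Rightarrow> 'b::comm_monoid_add"
  assumes "k \<noteq> l"
  shows "sum f UNIV = f k + f l + sum f (UNIV - {k, l})"
  using assms sum.remove[of UNIV k f] sum.remove[of "UNIV - {k}" l f]
  by (simp add: add.assoc Diff_insert2[symmetric] insert_commute)

lemma sum_move:
  fixes n :: "'a::finite \<Rightarrow> nat"
  assumes "k \<noteq> l" "1 \<le> n k"
  shows "sum (move k l n) UNIV = sum n UNIV"
proof -
  have "sum (move k l n) (UNIV - {k, l}) = sum n (UNIV - {k, l})"
    using assms by (intro sum.cong) (auto simp: move_simps)
  then show ?thesis
    using assms by (simp add: sum_split2[of k l] move_simps)
qed

lemma gamma_bar_Suc: "gamma_bar \<gamma> i (Suc m) = gamma_bar \<gamma> i m * \<gamma> i m"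
  by (simp add: gamma_bar_def)

text \<open>The fibres of \<open>g\<close> over different targets are disjoint, so no index is
  counted twice.\<close>

lemma sum_fibre_le:
  fixes f :: "'b \<Rightarrow> real" and g :: "'b \<Rightarrow> 'c"
  assumes "finite F" "finite I" "\<And>i. 0 \<le> f i"
  shows "(\<Sum>z\<in>F. \<Sum>i\<in>{i\<in>I. P i \<and> z = g i}. f i) \<le> (\<Sum>i\<in>I. f i)"
proof -
  have "(\<Sum>z\<in>F. \<Sum>i\<in>{i\<in>I. P i \<and> z = g i}. f i) = (\<Sum>i\<in>(\<Union>z\<in>F. {i\<in>I. P i \<and> z = g i}). f i)"
    using assms by (intro sum.UNION_disjoint[symmetric]) auto
  also have "\<dots> \<le> (\<Sum>i\<in>I. f i)"
    using assms by (intro sum_mono2) auto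
  finally show ?thesis .
qed

text \<open>\<open>gamma_bar\<close> is required to be positive only up to \<open>N\<close> because
  no site of a state in \<open>states N\<close> holds more than \<open>N\<close> tasks.\<close>

locale network =
  fixes \<gamma> :: "'a::finite \<Rightarrow> nat \<Rightarrow> real"
    and \<xi> \<eta> :: "'a \<Rightarrow> real"
    and \<beta> \<theta> \<epsilon> :: "'a \<Rightarrow> 'a \<Rightarrow> nat \<Rightarrow> nat \<Rightarrow> ('a \<Rightarrow> nat) \<Rightarrow> real"
    and \<tau> :: "'a \<Rightarrow> 'a \<Rightarrow> ('a \<Rightarrow> nat) \<Rightarrow> ('a \<Rightarrow> nat) \<Rightarrow> real"
    and N :: nat
  assumes \<gamma>_nonneg: "\<And>i m. \<gamma> i m \<ge> 0"
    and gamma_bar_pos: "\<And>i m. m \<le> N \<Longrightarrow> gamma_bar \<gamma> i m > 0"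
    and \<xi>_pos: "\<And>k. \<xi> k > 0"
    and \<eta>_pos: "\<And>k. \<eta> k > 0"
    and \<beta>_pos: "\<And>k l n y. k \<noteq> l \<Longrightarrow> y k = 0 \<Longrightarrow> y l = 0 \<Longrightarrow> \<beta> k l (n k) (n l) y > 0"
    and \<theta>_pos: "\<And>j k n y. y j \<ge> 1 \<Longrightarrow> y k = 0 \<Longrightarrow>
           \<theta> j k (n j) (n k) y > 0 \<and> \<theta> k j (n k) (n j) y > 0"
    and \<epsilon>_pos: "\<And>i j n y. i \<noteq> j \<Longrightarrow> y i \<ge> 1 \<Longrightarrow> y j \<ge> 1 \<Longrightarrow> \<epsilon> i j (n i) (n j) y > 0"
    and \<tau>_pos: "\<And>j j' n y. j' \<noteq> j \<Longrightarrow> y j \<ge> 1 \<Longrightarrow> \<tau> j j' n y > 0"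
    and \<beta>_sym: "\<And>k l n y. k \<noteq> l \<Longrightarrow> y k = 0 \<Longrightarrow> y l = 0 \<Longrightarrow> n k \<ge> 1 \<Longrightarrow>
           \<beta> k l (n k) (n l) y = \<beta> l k (n l + 1) (n k - 1) y"
    and \<theta>_sym: "\<And>j k n y. y j \<ge> 1 \<Longrightarrow> y k = 0 \<Longrightarrow> n j \<ge> 1 \<Longrightarrow>
           \<theta> j k (n j) (n k) y = \<theta> k j (n k + 1) (n j - 1) y"
    and \<epsilon>_sym: "\<And>i j n y. i \<noteq> j \<Longrightarrow> y i \<ge> 1 \<Longrightarrow> y j \<ge> 1 \<Longrightarrow> n i \<ge> 1 \<Longrightarrow>
           \<epsilon> i j (n i) (n j) y * \<gamma> i (n i - 1) ^ y i
         = \<gamma> j (n j) ^ y j * \<epsilon> j i (n j + 1) (n i - 1) y"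
    and \<tau>_sym: "\<And>j j' n y. y j \<ge> 1 \<Longrightarrow> j' \<noteq> j \<Longrightarrow>
           \<tau> j j' n y * (\<xi> j / \<eta> j) = \<tau> j' j n (move j j' y) * (\<xi> j' / \<eta> j')"
    and finite_partition_sum: "partition_sum \<gamma> \<xi> \<eta> N < \<infinity>"
begin

abbreviation task :: "('a \<Rightarrow> nat) \<Rightarrow> ('a \<Rightarrow> nat) \<Rightarrow> 'a \<Rightarrow> 'a \<Rightarrow> real" where
  "task \<equiv> task_rate \<gamma> \<beta> \<theta> \<epsilon>"
abbreviation customer :: "('a \<Rightarrow> nat) \<Rightarrow> ('a \<Rightarrow> nat) \<Rightarrow> 'a \<Rightarrow> 'a \<Rightarrow> real" where
  "customer \<equiv> customer_rate \<gamma> \<tau>"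
abbreviation gbar :: "'a \<Rightarrow> nat \<Rightarrow> real" where "gbar \<equiv> gamma_bar \<gamma>"
abbreviation rate :: "'a state \<Rightarrow> 'a state \<Rightarrow> real" where
  "rate \<equiv> network_rate \<gamma> \<xi> \<eta> \<beta> \<theta> \<epsilon> \<tau>"
abbreviation Q :: "'a state \<Rightarrow> 'a state \<Rightarrow> real" where
  "Q \<equiv> network_generator \<gamma> \<xi> \<eta> \<beta> \<theta> \<epsilon> \<tau>"
abbreviation w :: "'a state \<Rightarrow> real" where "w \<equiv> weight \<gamma> \<xi> \<eta>"

lemma gbar_nonneg: "0 \<le> gbar i m"
  by (simp add: gamma_bar_def prod_nonneg \<gamma>_nonneg)

lemma task_nonneg:
  assumes "k \<noteq> l"
  shows "0 \<le> task y n k l"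
proof -
  have "0 \<le> \<beta> k l (n k) (n l) y" if "y k = 0" "y l = 0"
    using \<beta>_pos[of k l y n] that assms by simp
  moreover have "0 \<le> \<epsilon> k l (n k) (n l) y" if "1 \<le> y k" "1 \<le> y l"
    using \<epsilon>_pos[of k l y n] that assms by simp
  moreover have "0 \<le> \<theta> k l (n k) (n l) y" if "1 \<le> y k" "y l = 0"
    using \<theta>_pos[of y k l n] that by simp
  moreover have "0 \<le> \<theta> k l (n k) (n l) y" if "y k = 0" "1 \<le> y l"
    using \<theta>_pos[of y l k n] that by simp
  ultimately show ?thesis
    using \<gamma>_nonneg[of l "n l"] by (cases "y k = 0"; cases "y l = 0") (simp_all add: task_rate_def)
qed

lemma customer_nonneg:
  assumes "j \<noteq> j'" "1 \<le> y j"
  shows "0 \<le> customer y n j j'"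
proof -
  have "0 \<le> \<tau> j j' n y" using \<tau>_pos[of j' j y n] assms by simp
  then show ?thesis using gbar_nonneg by (simp add: customer_rate_def)
qed

lemma arrival_nonneg: "0 \<le> \<xi> p * gbar p m"
  using gbar_nonneg[of p m] \<xi>_pos[of p] by simp

lemma \<eta>_nonneg: "0 \<le> \<eta> p"
  using \<eta>_pos[of p] by simp

lemma rate_parts_nonneg:
  "0 \<le> (\<Sum>(k, l) \<in> {(k, l). k \<noteq> l \<and> n k \<ge> 1 \<and> y' = y \<and> n' = move k l n}. task y n k l)"
  "0 \<le> (\<Sum>(j, j') \<in> {(j, j'). j \<noteq> j' \<and> y j \<ge> 1 \<and> y' = move j j' y \<and> n' = n}. customer y n j j')"
  "0 \<le> (\<Sum>p \<in> {p. y' = y(p := y p + 1) \<and> n' = n}. \<xi> p * gbar p (n p))"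
  "0 \<le> (\<Sum>p \<in> {p. y p \<ge> 1 \<and> y' = y(p := y p - 1) \<and> n' = n}. \<eta> p)"
  by (rule sum_nonneg, use task_nonneg customer_nonneg in \<open>auto simp: arrival_nonneg \<eta>_nonneg\<close>)+

lemma rate_nonneg: "0 \<le> rate x z"
  unfolding network_rate_def using rate_parts_nonneg
  by (cases x; cases z) (simp only: case_prod_conv add_nonneg_nonneg)

lemma rate_pos_task:
  assumes "k \<noteq> l" "1 \<le> n k" "0 < task y n k l"
  shows "0 < rate (y, n) (y, move k l n)"
proof -
  have "0 < (\<Sum>(k', l') \<in> {(k', l'). k' \<noteq> l' \<and> n k' \<ge> 1 \<and> y = y \<and> move k l n = move k' l' n}. task y n k' l')"
    using assms task_nonneg by (intro sum_pos2[where i="(k, l)"]) auto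
  then show ?thesis
    unfolding network_rate_def case_prod_conv by (intro add_pos_nonneg rate_parts_nonneg)
qed

lemma rate_pos_arrival:
  assumes "0 < gbar p (n p)"
  shows "0 < rate (y, n) (y(p := y p + 1), n)"
proof -
  have "0 < (\<Sum>p' \<in> {p'. y(p := y p + 1) = y(p' := y p' + 1) \<and> n = n}. \<xi> p' * gbar p' (n p'))"
    using assms \<xi>_pos by (intro sum_pos2[where i=p]) (auto simp: arrival_nonneg)
  then show ?thesis
    unfolding network_rate_def case_prod_conv
    by (intro add_pos_nonneg[OF add_nonneg_pos] add_nonneg_nonneg rate_parts_nonneg)
qed

lemma rate_pos_departure:
  assumes "1 \<le> y p"
  shows "0 < rate (y, n) (y(p := y p - 1), n)"
proof -
  have "0 < (\<Sum>p' \<in> {p'. y p' \<ge> 1 \<and> y(p := y p - 1) = y(p' := y p' - 1) \<and> n = n}. \<eta> p')"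
    using assms \<eta>_pos by (intro sum_pos2[where i=p]) (auto simp: \<eta>_nonneg)
  then show ?thesis
    unfolding network_rate_def case_prod_conv
    by (intro add_nonneg_pos add_nonneg_nonneg rate_parts_nonneg)
qed

text \<open>A finite set carrying all nonzero rates out of a state; through it the infinite sum in
  the generator becomes finite.\<close>

definition targets :: "'a state \<Rightarrow> 'a state set" where
  "targets = (\<lambda>(y, n). {(y, move k l n) |k l. k \<noteq> l \<and> n k \<ge> 1} \<union> {(move j j' y, n) |j j'. j \<noteq> j' \<and> y j \<ge> 1}
     \<union> {(y(p := y p + 1), n) |p. True} \<union> {(y(p := y p - 1), n) |p. y p \<ge> 1})"

lemma finite_targets: "finite (targets x)"
proof -
  obtain y n where x: "x = (y, n)" by (cases x)
  have "targets x \<subseteq> (\<lambda>(k, l). (y, move k l n)) ` UNIV \<union> (\<lambda>(k, l). (move k l y, n)) ` UNIV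
     \<union> (\<lambda>p. (y(p := y p + 1), n)) ` UNIV \<union> (\<lambda>p. (y(p := y p - 1), n)) ` UNIV"
    by (auto simp: targets_def x)
  then show ?thesis by (rule finite_subset) auto
qed

lemma rate_zero:
  assumes "z \<notin> targets x"
  shows "rate x z = 0"
proof -
  obtain y n y' n' where x: "x = (y, n)" and z: "z = (y', n')" by (cases x; cases z)
  have "{(k, l). k \<noteq> l \<and> n k \<ge> 1 \<and> y' = y \<and> n' = move k l n} = {}"
    "{(j, j'). j \<noteq> j' \<and> y j \<ge> 1 \<and> y' = move j j' y \<and> n' = n} = {}"
    "{p. y' = y(p := y p + 1) \<and> n' = n} = {}"
    "{p. y p \<ge> 1 \<and> y' = y(p := y p - 1) \<and> n' = n} = {}"
    using assms unfolding targets_def x z by blast+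
  then show ?thesis
    unfolding network_rate_def x z case_prod_conv by (simp only: sum.empty add_0)
qed

lemma self_not_target: "x \<notin> targets x"
proof
  assume "x \<in> targets x"
  moreover have "move k l n \<noteq> n" if "k \<noteq> l" for k l :: 'a and n
    using move_simps(2)[OF that, of n] by auto
  moreover have "y(p := Suc (y p)) \<noteq> y" for y :: "'a \<Rightarrow> nat" and p
    by (metis fun_upd_same n_not_Suc_n)
  moreover have "y(p := y p - Suc 0) \<noteq> y" if "0 < y p" for y :: "'a \<Rightarrow> nat" and p
    using that by (metis diff_less fun_upd_same less_irrefl zero_less_Suc)
  ultimately show False
    unfolding targets_def by (cases x) (fastforce simp: eq_commute)
qed

section \<open>Positivity of the weights and detailed balance\<close>

lemma targets_states: "x \<in> states N \<Longrightarrow> z \<in> targets x \<Longrightarrow> z \<in> states N"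
  by (cases x) (auto simp: targets_def states_def sum_move)

lemma le_N: "(y, n) \<in> states N \<Longrightarrow> n i \<le> N"
  using member_le_sum[of i UNIV n] by (auto simp: states_def)

lemma gbar_pos: "(y, n) \<in> states N \<Longrightarrow> 0 < gbar i (n i)"
  by (intro gamma_bar_pos le_N)

lemma weight_pos: "x \<in> states N \<Longrightarrow> 0 < w x"
  using \<xi>_pos \<eta>_pos gbar_pos by (cases x) (auto simp: weight_def intro!: prod_pos zero_less_power divide_pos_pos mult_pos_pos)

text \<open>Factored with \<open>n k - 1\<close> tasks at \<open>k\<close> and \<open>n l\<close> at
  \<open>l\<close>, the two weights agree except for \<open>\<gamma> k (n k - 1) ^ y k\<close>
  before the move and \<open>\<gamma> l (n l) ^ y l\<close> after it. What remains is the symmetry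
  of \<open>\<beta>\<close>, \<open>\<theta>\<close> or \<open>\<epsilon>\<close>, according to
  which sites hold customers.\<close>

lemma task_balance:
  assumes "k \<noteq> l" and n: "1 \<le> n k"
  shows "w (y, n) * task y n k l = w (y, move k l n) * task y (move k l n) l k"
proof -
  let ?n = "move k l n"
  let ?P = "\<Prod>s\<in>UNIV - {k, l}. (\<xi> s / \<eta> s * gbar s (n s)) ^ y s"
  let ?u = "(\<xi> k / \<eta> k * gbar k (n k - 1)) ^ y k" and ?v = "(\<xi> l / \<eta> l * gbar l (n l)) ^ y l"
  have gk: "gbar k (n k) = gbar k (n k - 1) * \<gamma> k (n k - 1)"
    using gamma_bar_Suc[of \<gamma> k "n k - 1"] n by simp
  have w1: "w (y, n) = ?u * ?v * ?P * \<gamma> k (n k - 1) ^ y k"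
    unfolding weight_def case_prod_conv prod_split2[OF \<open>k \<noteq> l\<close>] gk
    by (simp only: power_mult_distrib mult_ac)
  have P: "(\<Prod>s\<in>UNIV - {k, l}. (\<xi> s / \<eta> s * gbar s (?n s)) ^ y s) = ?P"
    using assms by (intro prod.cong) (auto simp: move_simps)
  have w2: "w (y, ?n) = ?u * ?v * ?P * \<gamma> l (n l) ^ y l"
    unfolding weight_def case_prod_conv prod_split2[OF \<open>k \<noteq> l\<close>] P
    by (simp only: move_simps(1,2)[OF \<open>k \<noteq> l\<close>] Suc_eq_plus1[symmetric] gamma_bar_Suc power_mult_distrib mult_ac)
  have "\<gamma> k (n k - 1) ^ y k * task y n k l = \<gamma> l (n l) ^ y l * task y ?n l k"
  proof (cases "y k = 0"; cases "y l = 0")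
    assume "y k = 0" "y l = 0"
    then show ?thesis
      using \<beta>_sym[of k l y n] assms by (simp add: task_rate_def move_simps)
  next
    assume "y k = 0" "y l \<noteq> 0"
    then show ?thesis
      \<comment> \<open>The symmetry of \<open>\<theta>\<close> starts from the site holding
        customers, here \<open>l\<close>, so it is applied in the state after the move.\<close>
      using \<theta>_sym[of y l k ?n] assms by (simp add: task_rate_def move_simps)
  next
    assume "y k \<noteq> 0" "y l = 0"
    then show ?thesis
      using \<theta>_sym[of y k l n] assms by (simp add: task_rate_def move_simps)
  next
    assume "y k \<noteq> 0" "y l \<noteq> 0"
    then show ?thesis
      using \<epsilon>_sym[of k l y n] assms by (simp add: task_rate_def move_simps mult.commute)
  qed
  then show ?thesis unfolding w1 w2 by (simp only: mult.assoc)
qed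

text \<open>On both sides the inverse powers in the rate cancel the powers of \<open>gbar\<close> at
  \<open>j\<close> and \<open>j'\<close> in the weight. With one factor
  \<open>\<xi> j / \<eta> j\<close> split off, the symmetry of \<open>\<tau>\<close> remains;
  dividing by \<open>gbar\<close> is where membership in \<open>states N\<close> enters.\<close>

lemma customer_balance:
  assumes "j \<noteq> j'" and y: "1 \<le> y j" and E: "(y, n) \<in> states N"
  shows "w (y, n) * customer y n j j' = w (move j j' y, n) * customer (move j j' y) n j' j"
proof -
  let ?y = "move j j' y"
  let ?P = "\<Prod>s\<in>UNIV - {j, j'}. (\<xi> s / \<eta> s * gbar s (n s)) ^ y s"
  let ?c = "\<xi> j / \<eta> j" and ?c' = "\<xi> j' / \<eta> j'" and ?g = "gbar j (n j)" and ?g' = "gbar j' (n j')"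
  obtain m where m: "y j = Suc m" using y by (cases "y j") auto
  have g: "?g \<noteq> 0" "?g' \<noteq> 0" using gbar_pos[OF E, of j] gbar_pos[OF E, of j'] by auto
  have P: "(\<Prod>s\<in>UNIV - {j, j'}. (\<xi> s / \<eta> s * gbar s (n s)) ^ ?y s) = ?P"
    using assms by (intro prod.cong) (auto simp: move_simps)
  have "w (y, n) * customer y n j j' = ?c ^ m * ?c' ^ y j' * ?P * (\<tau> j j' n y * ?c)"
    unfolding weight_def case_prod_conv prod_split2[OF \<open>j \<noteq> j'\<close>] customer_rate_def m
    using g by (simp add: power_mult_distrib field_simps)
  also have "\<dots> = ?c ^ m * ?c' ^ y j' * ?P * (\<tau> j' j n ?y * ?c')"
    using \<tau>_sym[of y j j' n] assms by simp
  also have "\<dots> = w (?y, n) * customer ?y n j' j"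
    unfolding weight_def case_prod_conv prod_split2[OF \<open>j \<noteq> j'\<close>] customer_rate_def P
    using g by (simp add: move_simps[OF \<open>j \<noteq> j'\<close>] m power_mult_distrib field_simps)
  finally show ?thesis .
qed

lemma arrival_balance: "w (y, n) * (\<xi> p * gbar p (n p)) = w (y(p := y p + 1), n) * \<eta> p"
proof -
  let ?f = "\<lambda>s. (\<xi> s / \<eta> s * gbar s (n s))"
  have "(\<Prod>s\<in>UNIV - {p}. ?f s ^ (y(p := y p + 1)) s) = (\<Prod>s\<in>UNIV - {p}. ?f s ^ y s)"
    by (intro prod.cong) auto
  then show ?thesis
    using \<eta>_pos[of p] unfolding weight_def case_prod_conv
    by (subst (1 2) prod.remove[of UNIV p]) (simp_all add: field_simps)
qed

lemma move_swap:
  assumes "k \<noteq> l" "1 \<le> v k" "v' = move k l v"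
  shows "1 \<le> v' l" "v = move l k v'"
  using assms move_back[of k l v] by (simp_all add: move_simps)

text \<open>Swapping the two sites matches the moves from \<open>x\<close> to \<open>z\<close> with
  those from \<open>z\<close> to \<open>x\<close>, and arrivals in one direction match departures in
  the other.\<close>

lemma rate_balance:
  assumes E: "x \<in> states N" "z \<in> states N"
  shows "w x * rate x z = w z * rate z x"
proof -
  obtain y n y' n' where x: "x = (y, n)" and z: "z = (y', n')" by (cases x; cases z)
  let ?I = "\<lambda>y n y' n'. {(k, l). k \<noteq> l \<and> n k \<ge> 1 \<and> y' = y \<and> n' = move k l n}"
  let ?J = "\<lambda>y n y' n'. {(j, j'). j \<noteq> j' \<and> y j \<ge> 1 \<and> y' = move j j' y \<and> n' = n}"
  have I: "prod.swap a \<in> ?I y' n' y n" if "a \<in> ?I y n y' n'" for a :: "'a \<times> 'a" and y n y' n' :: "'a \<Rightarrow> nat"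
    using that move_swap[of "fst a" "snd a" n n'] by (auto simp: case_prod_beta)
  have J: "prod.swap a \<in> ?J y' n' y n" if "a \<in> ?J y n y' n'" for a :: "'a \<times> 'a" and y n y' n' :: "'a \<Rightarrow> nat"
    using that move_swap[of "fst a" "snd a" y y'] by (auto simp: case_prod_beta)
  have 1: "w x * (\<Sum>(k, l) \<in> ?I y n y' n'. task y n k l) = w z * (\<Sum>(k, l) \<in> ?I y' n' y n. task y' n' k l)"
    unfolding sum_distrib_left
  proof (rule sum.reindex_bij_witness[of _ prod.swap prod.swap])
    fix a assume "a \<in> ?I y n y' n'"
    then show "w z * (case prod.swap a of (k, l) \<Rightarrow> task y' n' k l) = w x * (case a of (k, l) \<Rightarrow> task y n k l)"
      using task_balance[of "fst a" "snd a" n y] by (simp add: x z case_prod_beta)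
  qed (simp_all only: I swap_swap)
  have 2: "w x * (\<Sum>(j, j') \<in> ?J y n y' n'. customer y n j j') = w z * (\<Sum>(j, j') \<in> ?J y' n' y n. customer y' n' j j')"
    unfolding sum_distrib_left
  proof (rule sum.reindex_bij_witness[of _ prod.swap prod.swap])
    fix a assume "a \<in> ?J y n y' n'"
    then show "w z * (case prod.swap a of (k, l) \<Rightarrow> customer y' n' k l) = w x * (case a of (k, l) \<Rightarrow> customer y n k l)"
      using customer_balance[of "fst a" "snd a" y n] E by (simp add: x z case_prod_beta)
  qed (simp_all only: J swap_swap)
  have 3: "w (a, b) * (\<Sum>p \<in> {p. a' = a(p := a p + 1) \<and> b' = b}. \<xi> p * gbar p (b p)) =
      w (a', b') * (\<Sum>p \<in> {p. a' p \<ge> 1 \<and> a = a'(p := a' p - 1) \<and> b = b'}. \<eta> p)" for a b a' b'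
    unfolding sum_distrib_left
  proof (rule sum.cong)
    show "{p. a' = a(p := a p + 1) \<and> b' = b} = {p. a' p \<ge> 1 \<and> a = a'(p := a' p - 1) \<and> b = b'}"
    proof (intro Collect_cong iffI)
      fix p assume "a' = a(p := a p + 1) \<and> b' = b"
      then show "a' p \<ge> 1 \<and> a = a'(p := a' p - 1) \<and> b = b'" by simp
    next
      fix p assume "a' p \<ge> 1 \<and> a = a'(p := a' p - 1) \<and> b = b'"
      then show "a' = a(p := a p + 1) \<and> b' = b" by simp
    qed
    fix p assume "p \<in> {p. a' p \<ge> 1 \<and> a = a'(p := a' p - 1) \<and> b = b'}"
    then have "a' = a(p := a p + 1)" "b' = b" by simp_all
    then show "w (a, b) * (\<xi> p * gbar p (b p)) = w (a', b') * \<eta> p"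
      using arrival_balance[of a b p] by simp
  qed
  show ?thesis
    using 1 2 3[of y n y' n'] 3[of y' n' y n]
    unfolding x z network_rate_def case_prod_conv distrib_left by (simp only: add_ac)
qed


section \<open>The jump chain of the network\<close>

definition total_rate :: "'a state \<Rightarrow> real" where
  "total_rate x = (\<Sum>z\<in>targets x. rate x z)"

lemma Q_self: "Q x x = - total_rate x"
proof -
  have "(\<Sum>\<^sub>\<infinity>z\<in>UNIV - {x}. rate x z) = (\<Sum>\<^sub>\<infinity>z\<in>targets x. rate x z)"
    using self_not_target by (intro infsum_cong_neutral) (auto intro: rate_zero)
  then show ?thesis
    by (simp add: network_generator_def total_rate_def finite_targets)
qed

lemma total_rate_pos:
  assumes "x \<in> states N"
  shows "0 < total_rate x"
proof -
  obtain y n where x: "x = (y, n)" by (cases x)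
  \<comment> \<open>A type has an element, so there is a site, and an arrival there has positive
    rate.\<close>
  fix p :: 'a
  have "0 < rate x (y(p := y p + 1), n)"
    unfolding x using gbar_pos assms x by (intro rate_pos_arrival) auto
  moreover have "(y(p := y p + 1), n) \<in> targets x" by (auto simp: targets_def x)
  ultimately show ?thesis
    unfolding total_rate_def by (intro sum_pos2[OF finite_targets]) (auto intro: rate_nonneg)
qed

lemma hold_rate_Q: "x \<in> states N \<Longrightarrow> hold_rate Q x = total_rate x"
  using total_rate_pos by (simp add: hold_rate_def Q_self)

lemma pmf_jump:
  assumes x: "x \<in> states N"
  shows "pmf (jump_pmf Q x) z = rate x z / total_rate x"
proof -
  have pos: "0 < total_rate x" by (rule total_rate_pos[OF x])
  have eq: "(\<lambda>z. if z = x then 0 else Q x z / (- Q x x)) = (\<lambda>z. rate x z / total_rate x)"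
  proof
    fix z
    have "Q x z = rate x z" if "z \<noteq> x" using that by (simp add: network_generator_def)
    then show "(if z = x then 0 else Q x z / (- Q x x)) = rate x z / total_rate x"
      using rate_zero[OF self_not_target] by (simp add: Q_self)
  qed
  \<comment> \<open>\<open>embed_pmf\<close> yields the intended probabilities once the total mass
    is known to be 1.\<close>
  have "(\<integral>\<^sup>+z. ennreal (rate x z / total_rate x) \<partial>count_space UNIV) =
      (\<Sum>z\<in>targets x. ennreal (rate x z / total_rate x))"
    using finite_targets rate_zero by (intro nn_integral_count_space') auto
  also have "\<dots> = ennreal (\<Sum>z\<in>targets x. rate x z / total_rate x)"
    using rate_nonneg pos by (intro sum_ennreal) (auto intro: divide_nonneg_pos)
  also have "(\<Sum>z\<in>targets x. rate x z / total_rate x) = 1"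
    using pos by (simp add: sum_divide_distrib[symmetric] total_rate_def[symmetric])
  finally have "(\<integral>\<^sup>+z. ennreal (rate x z / total_rate x) \<partial>count_space UNIV) = 1" by simp
  then show ?thesis
    unfolding jump_pmf_def eq using pos rate_nonneg
    by (simp add: Q_self) (subst pmf_embed_pmf, auto)
qed

lemma set_jump_pmf: "x \<in> states N \<Longrightarrow> set_pmf (jump_pmf Q x) \<subseteq> targets x"
  by (auto simp: set_pmf_iff pmf_jump intro: ccontr rate_zero)

lemma rate_pmf: "x \<in> states N \<Longrightarrow> hold_rate Q x * pmf (jump_pmf Q x) z = rate x z"
  using total_rate_pos[of x] by (simp add: pmf_jump hold_rate_Q)

section \<open>Normalisation of the weights\<close>

abbreviation Z :: real where "Z \<equiv> enn2real (partition_sum \<gamma> \<xi> \<eta> N)"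

lemma weight_nonneg: "x \<in> states N \<Longrightarrow> 0 \<le> w x"
  by (simp add: weight_pos less_imp_le)

lemma weight_has_sum: "(w has_sum Z) (states N)" and Z_pos: "0 < Z"
proof -
  let ?S = "partition_sum \<gamma> \<xi> \<eta> N"
  have S: "?S = (SUP F\<in>{F. finite F \<and> F \<subseteq> states N}. \<Sum>x\<in>F. ennreal (w x))"
    unfolding partition_sum_def by (rule nonneg_infsum_complete) simp
  have sum: "(\<Sum>x\<in>F. ennreal (w x)) = ennreal (\<Sum>x\<in>F. w x)" if "F \<subseteq> states N" for F
    using that by (intro sum_ennreal weight_nonneg) blast
  have bound: "(\<Sum>x\<in>F. w x) \<le> Z" if F: "finite F" "F \<subseteq> states N" for F
  proof -
    have "ennreal (\<Sum>x\<in>F. w x) \<le> ?S"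
      unfolding S sum[OF F(2), symmetric] by (rule SUP_upper) (simp add: F)
    then have "enn2real (ennreal (\<Sum>x\<in>F. w x)) \<le> Z"
      using finite_partition_sum by (intro enn2real_mono) simp_all
    moreover have "0 \<le> (\<Sum>x\<in>F. w x)"
      using F by (intro sum_nonneg weight_nonneg) blast
    ultimately show ?thesis by simp
  qed
  have "bdd_above (sum w ` {F. F \<subseteq> states N \<and> finite F})"
    by (rule bdd_aboveI2[where M=Z]) (simp add: bound)
  then have summable: "w summable_on states N"
    by (intro nonneg_bdd_above_summable_on weight_nonneg)
  have "ennreal (infsum w (states N)) = (SUP F\<in>{F. finite F \<and> F \<subseteq> states N}. ennreal (sum w F))"
    by (rule infsum_nonneg_is_SUPREMUM_ennreal[OF summable weight_nonneg])
  also have "\<dots> = ?S"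
    unfolding S by (intro SUP_cong refl) (simp add: sum)
  finally have "?S = ennreal (infsum w (states N))" ..
  moreover have "0 \<le> infsum w (states N)"
    by (rule infsum_nonneg) (rule weight_nonneg)
  ultimately have Z: "Z = infsum w (states N)" by simp
  then show "(w has_sum Z) (states N)"
    using has_sum_infsum[OF summable] by simp
  \<comment> \<open>One state of positive weight is enough for \<open>Z > 0\<close>: no customers,
    all tasks at one site.\<close>
  fix s0 :: 'a
  let ?x = "((\<lambda>_. 0), (\<lambda>s. if s = s0 then N else 0)) :: 'a state"
  have x: "?x \<in> states N" by (simp add: states_def)
  have "sum w {?x} \<le> infsum w (states N)"
    by (rule finite_sum_le_infsum[OF summable]) (use x weight_nonneg in simp_all)
  then show "0 < Z" using Z weight_pos[OF x] by simp
qed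

abbreviation \<pi> :: "'a state \<Rightarrow> real" where "\<pi> \<equiv> equilibrium \<gamma> \<xi> \<eta> N"

lemma equilibrium_eq: "x \<in> states N \<Longrightarrow> \<pi> x = w x / Z" "x \<notin> states N \<Longrightarrow> \<pi> x = 0"
  by (simp_all add: equilibrium_def)

text \<open>Valid for all states of the type: off \<open>states N\<close> the weight is zero, and no
  transition leaves \<open>states N\<close>.\<close>

lemma equilibrium_balance:
  "\<pi> x * (hold_rate Q x * pmf (jump_pmf Q x) z) = \<pi> z * (hold_rate Q z * pmf (jump_pmf Q z) x)"
proof -
  have out: "\<pi> x * (hold_rate Q x * pmf (jump_pmf Q x) z) = 0" if "x \<notin> states N \<or> z \<notin> states N" for x z
  proof (cases "x \<in> states N")
    case True
    then have "rate x z = 0" using that targets_states rate_zero by blast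
    then show ?thesis using True by (simp only: rate_pmf mult_zero_right)
  qed (simp add: equilibrium_eq)
  show ?thesis
  proof (cases "x \<in> states N \<and> z \<in> states N")
    case True
    then show ?thesis
      using rate_balance[of x z] by (simp add: rate_pmf equilibrium_eq)
  next
    case False
    then show ?thesis using out[of x z] out[of z x] by auto
  qed
qed

section \<open>Bounded rate of change of the number of customers\<close>

definition customers :: "'a state \<Rightarrow> nat" where
  "customers x = sum (fst x) UNIV"

lemma finite_customers: "finite {x \<in> states N. customers x = k}"
proof (rule finite_subset)
  show "{x \<in> states N. customers x = k} \<subseteq> (PiE UNIV (\<lambda>_. {..k})) \<times> (PiE UNIV (\<lambda>_. {..N}))"
    using member_le_sum[of _ UNIV "fst _ :: 'a \<Rightarrow> nat"] le_N by (auto simp: customers_def) 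
qed (auto intro!: finite_cartesian_product finite_PiE)

text \<open>The arrival rate depends on the state only through \<open>n p\<close>, which lies in
  \<open>{..N}\<close>; summing over all these values gives one bound for all states.\<close>

definition customer_change_bound :: real where
  "customer_change_bound = (\<Sum>p\<in>UNIV. \<Sum>m\<le>N. \<xi> p * gbar p m) + (\<Sum>p\<in>UNIV. \<eta> p)"

lemma customer_change_bound_nonneg: "0 \<le> customer_change_bound"
  unfolding customer_change_bound_def by (intro add_nonneg_nonneg sum_nonneg arrival_nonneg \<eta>_nonneg)

lemma customer_change_rate:
  assumes x: "x \<in> states N"
  shows "hold_rate Q x * measure (jump_pmf Q x) {z. customers z \<noteq> customers x} \<le> customer_change_bound"
proof -
  obtain y n where xy: "x = (y, n)" by (cases x)
  let ?F = "{z \<in> targets x. customers z \<noteq> customers x}"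
  have F: "finite ?F" using finite_targets by auto
  have "measure (jump_pmf Q x) {z. customers z \<noteq> customers x} = measure (jump_pmf Q x) ?F"
    using set_jump_pmf[OF x] by (intro measure_eq_AE) (auto simp: AE_measure_pmf_iff)
  also have "\<dots> = (\<Sum>z\<in>?F. pmf (jump_pmf Q x) z)"
    by (rule measure_measure_pmf_finite[OF F])
  finally have "hold_rate Q x * measure (jump_pmf Q x) {z. customers z \<noteq> customers x} = (\<Sum>z\<in>?F. rate x z)"
    by (simp add: sum_distrib_left rate_pmf[OF x])
  also have "\<dots> = (\<Sum>z\<in>?F. (\<Sum>p\<in>{p\<in>UNIV. True \<and> z = (y(p := y p + 1), n)}. \<xi> p * gbar p (n p)) +
      (\<Sum>p\<in>{p\<in>UNIV. y p \<ge> 1 \<and> z = (y(p := y p - 1), n)}. \<eta> p))"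
  proof (rule sum.cong)
    fix z assume z: "z \<in> ?F"
    obtain y' n' where zy: "z = (y', n')" by (cases z)
    \<comment> \<open>Moves of tasks or customers between sites keep the number of customers, so
      only arrivals and departures contribute.\<close>
    have "{(k, l). k \<noteq> l \<and> n k \<ge> 1 \<and> y' = y \<and> n' = move k l n} = {}"
      using z by (auto simp: xy zy customers_def)
    moreover have "{(j, j'). j \<noteq> j' \<and> y j \<ge> 1 \<and> y' = move j j' y \<and> n' = n} = {}"
      using z sum_move[of _ _ y] by (auto simp: xy zy customers_def)
    ultimately show "rate x z = (\<Sum>p\<in>{p\<in>UNIV. True \<and> z = (y(p := y p + 1), n)}. \<xi> p * gbar p (n p)) +
      (\<Sum>p\<in>{p\<in>UNIV. y p \<ge> 1 \<and> z = (y(p := y p - 1), n)}. \<eta> p)"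
      unfolding xy zy network_rate_def case_prod_conv by (simp only: sum.empty add_0 prod.inject UNIV_I simp_thms)
  qed simp
  also have "\<dots> \<le> (\<Sum>p\<in>UNIV. \<xi> p * gbar p (n p)) + (\<Sum>p\<in>UNIV. \<eta> p)"
    unfolding sum.distrib using F by (intro add_mono sum_fibre_le) (auto simp: arrival_nonneg \<eta>_nonneg)
  also have "\<dots> \<le> customer_change_bound"
    unfolding customer_change_bound_def
  proof (intro add_right_mono sum_mono)
    fix p
    show "\<xi> p * gbar p (n p) \<le> (\<Sum>m\<le>N. \<xi> p * gbar p m)"
      using le_N[of y n p] x by (intro member_le_sum) (auto simp: xy arrival_nonneg)
  qed
  finally show ?thesis .
qed

section \<open>Irreducibility\<close>

abbreviation steps_to :: "('a state \<times> 'a state) set" where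
  "steps_to \<equiv> {(x, z). 0 < pmf (jump_pmf Q x) z}"

lemma step_to: "x \<in> states N \<Longrightarrow> 0 < rate x z \<Longrightarrow> (x, z) \<in> steps_to \<and> z \<in> states N"
  using total_rate_pos[of x] rate_zero[of z x] targets_states[of x z] by (auto simp: pmf_jump)

text \<open>Balance with positive weights makes every possible transition possible in reverse, so a
  path to a reference state also leads back.\<close>

lemma step_back:
  assumes "x \<in> states N" "0 < rate x z"
  shows "(z, x) \<in> steps_to"
proof -
  have z: "z \<in> states N" using step_to[OF assms] by simp
  have "w z * rate z x = w x * rate x z" by (rule rate_balance[OF z assms(1)])
  also have "\<dots> > 0" using weight_pos[OF assms(1)] assms(2) by simp
  finally have "0 < rate z x" using weight_pos[OF z] by (simp add: zero_less_mult_iff)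
  then show ?thesis using step_to[OF z] by blast
qed

definition linked :: "'a state \<Rightarrow> 'a state \<Rightarrow> bool" where
  "linked x z \<longleftrightarrow> z \<in> states N \<and> (x, z) \<in> steps_to\<^sup>* \<and> (z, x) \<in> steps_to\<^sup>*"

lemma linked_step:
  assumes "x \<in> states N" "0 < rate x x'" "x' \<in> states N \<Longrightarrow> linked x' z"
  shows "linked x z"
  using step_to[OF assms(1,2)] step_back[OF assms(1,2)] assms(3)
  unfolding linked_def by (meson converse_rtrancl_into_rtrancl rtrancl.rtrancl_into_rtrancl)

lemma linked_empty: "(y, n) \<in> states N \<Longrightarrow> linked (y, n) (\<lambda>_. 0, n)"
proof (induction "sum y UNIV" arbitrary: y)
  case 0
  then have "y = (\<lambda>_. 0)" by auto
  then show ?case using 0 by (simp add: linked_def)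
next
  case (Suc k)
  then obtain p where p: "1 \<le> y p"
    by (metis One_nat_def Suc_leI Zero_not_Suc gr0I sum.neutral)
  have "sum y UNIV = y p + sum y (UNIV - {p})" by (rule sum.remove) auto
  moreover have "sum (y(p := y p - 1)) UNIV = (y p - 1) + sum (y(p := y p - 1)) (UNIV - {p})"
    by (subst sum.remove[of _ p]) auto
  moreover have "sum (y(p := y p - 1)) (UNIV - {p}) = sum y (UNIV - {p})"
    by (intro sum.cong) auto
  ultimately have "k = sum (y(p := y p - 1)) UNIV" using Suc.hyps(2) p by linarith
  then show ?case
    using Suc.hyps(1) by (intro linked_step[OF Suc.prems rate_pos_departure[of y p n, OF p]]) auto
qed

text \<open>Without customers every task move has a positive rate \<open>\<beta>\<close>, so the
  tasks can be brought to \<open>s0\<close> one at a time.\<close>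

lemma linked_concentrated:
  "(\<lambda>_. 0, n) \<in> states N \<Longrightarrow> linked (\<lambda>_. 0, n) (\<lambda>_. 0, \<lambda>s. if s = s0 then N else 0)"
proof (induction "N - n s0" arbitrary: n)
  case 0
  have "sum n UNIV = n s0 + sum n (UNIV - {s0})" by (rule sum.remove) auto
  moreover have "sum n UNIV = N" using 0 by (simp add: states_def)
  ultimately have "n s0 = N" "sum n (UNIV - {s0}) = 0" using 0 by linarith+
  then have "n = (\<lambda>s. if s = s0 then N else 0)" by (auto simp: fun_eq_iff)
  then show ?case using 0 by (simp add: linked_def)
next
  case (Suc k)
  have "sum n UNIV = n s0 + sum n (UNIV - {s0})" by (rule sum.remove) auto
  moreover have "sum n UNIV = N" using Suc.prems by (simp add: states_def)
  ultimately have "sum n (UNIV - {s0}) \<noteq> 0" using Suc.hyps(2) by linarith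
  then obtain l where l: "l \<noteq> s0" "1 \<le> n l"
    by (metis DiffD2 One_nat_def Suc_leI gr0I singletonI sum.neutral)
  have "0 < task (\<lambda>_. 0) n l s0"
    using \<beta>_pos[of l s0 "\<lambda>_. 0" n] l by (simp add: task_rate_def)
  moreover have "k = N - move l s0 n s0"
    using Suc.hyps(2) l by (simp add: move_simps)
  ultimately show ?case
    using Suc.hyps(1)[of "move l s0 n"] l by (intro linked_step[OF Suc.prems rate_pos_task[of l s0 n]]) auto
qed

text \<open>All states communicate through one reference state: customers depart first, then the
  tasks gather at one site.\<close>

lemma network_irreducible:
  assumes "x \<in> states N" "z \<in> states N"
  shows "(x, z) \<in> steps_to\<^sup>*"
proof -
  fix s0 :: 'a
  let ?b = "((\<lambda>_. 0), (\<lambda>s. if s = s0 then N else 0)) :: 'a state"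
  have "linked x ?b" if "x \<in> states N" for x
  proof (cases x)
    case (Pair y n)
    then show ?thesis
      using linked_empty[of y n] linked_concentrated[of n s0] that
      unfolding linked_def by (meson rtrancl_trans)
  qed
  from this[OF assms(1)] this[OF assms(2)] show ?thesis
    unfolding linked_def by (meson rtrancl_trans)
qed

sublocale chain: reversible_jump_process Q "states N" \<pi> customers customer_change_bound
proof
  fix x z :: "'a state" and k
  show "0 < \<pi> x" if "x \<in> states N"
    using that weight_pos Z_pos by (simp add: equilibrium_eq)
  show "\<pi> x = 0" if "x \<notin> states N"
    using that by (rule equilibrium_eq)
  have "((\<lambda>x. w x / Z) has_sum (Z / Z)) (states N)"
    using has_sum_cmult_left[OF weight_has_sum, of "1 / Z"] by simp
  then show "(\<pi> has_sum 1) (states N)"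
    using Z_pos equilibrium_eq(1) by (subst has_sum_cong) auto
  show "set_pmf (jump_pmf Q x) \<subseteq> states N" if "x \<in> states N"
    using set_jump_pmf[OF that] targets_states[OF that] by blast
  show "\<pi> x * (hold_rate Q x * pmf (jump_pmf Q x) z) = \<pi> z * (hold_rate Q z * pmf (jump_pmf Q z) x)"
    by (rule equilibrium_balance)
  show "0 \<le> customer_change_bound" by (rule customer_change_bound_nonneg)
  show "finite {x \<in> states N. customers x = k}" by (rule finite_customers)
  show "hold_rate Q x * measure (jump_pmf Q x) {z. customers z \<noteq> customers x} \<le> customer_change_bound"
    if "x \<in> states N" using that by (rule customer_change_rate)
  show "(x, z) \<in> steps_to\<^sup>*" if "x \<in> states N" "z \<in> states N"
    using that by (rule network_irreducible)
qed

end

theorem theorem5p4: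
  fixes \<gamma> :: "'a::finite \<Rightarrow> nat \<Rightarrow> real"
    and \<xi> \<eta> :: "'a \<Rightarrow> real"
    and \<beta> \<theta> \<epsilon> :: "'a \<Rightarrow> 'a \<Rightarrow> nat \<Rightarrow> nat \<Rightarrow> ('a \<Rightarrow> nat) \<Rightarrow> real"
    and \<tau> :: "'a \<Rightarrow> 'a \<Rightarrow> ('a \<Rightarrow> nat) \<Rightarrow> ('a \<Rightarrow> nat) \<Rightarrow> real"
    and N :: nat
  assumes "\<And>i m. \<gamma> i m \<ge> 0"
    and "\<And>i. \<gamma> i 0 = 1"
    and "\<And>i m. \<gamma> i (m + 1) > 0 \<Longrightarrow> \<gamma> i m > 0"
    and "\<And>i m. m \<le> N \<Longrightarrow> gamma_bar \<gamma> i m > 0"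
    and "\<And>k. \<xi> k > 0"
    and "\<And>k. \<eta> k > 0"
    and "\<And>k l n y. k \<noteq> l \<Longrightarrow> y k = 0 \<Longrightarrow> y l = 0 \<Longrightarrow> \<beta> k l (n k) (n l) y > 0"
    and "\<And>j k n y. y j \<ge> 1 \<Longrightarrow> y k = 0 \<Longrightarrow>
           \<theta> j k (n j) (n k) y > 0 \<and> \<theta> k j (n k) (n j) y > 0"
    and "\<And>i j n y. i \<noteq> j \<Longrightarrow> y i \<ge> 1 \<Longrightarrow> y j \<ge> 1 \<Longrightarrow> \<epsilon> i j (n i) (n j) y > 0"
    and "\<And>j j' n y. j' \<noteq> j \<Longrightarrow> y j \<ge> 1 \<Longrightarrow> \<tau> j j' n y > 0"
    and "\<And>k l n y. k \<noteq> l \<Longrightarrow> y k = 0 \<Longrightarrow> y l = 0 \<Longrightarrow> n k \<ge> 1 \<Longrightarrow>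
           \<beta> k l (n k) (n l) y = \<beta> l k (n l + 1) (n k - 1) y"
    and "\<And>j k n y. y j \<ge> 1 \<Longrightarrow> y k = 0 \<Longrightarrow> n j \<ge> 1 \<Longrightarrow>
           \<theta> j k (n j) (n k) y = \<theta> k j (n k + 1) (n j - 1) y"
    and "\<And>i j n y. i \<noteq> j \<Longrightarrow> y i \<ge> 1 \<Longrightarrow> y j \<ge> 1 \<Longrightarrow> n i \<ge> 1 \<Longrightarrow>
           \<epsilon> i j (n i) (n j) y * \<gamma> i (n i - 1) ^ y i
         = \<gamma> j (n j) ^ y j * \<epsilon> j i (n j + 1) (n i - 1) y"
    and "\<And>j j' n y. y j \<ge> 1 \<Longrightarrow> j' \<noteq> j \<Longrightarrow>
           \<tau> j j' n y * (\<xi> j / \<eta> j) = \<tau> j' j n (move j j' y) * (\<xi> j' / \<eta> j')"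
    and "partition_sum \<gamma> \<xi> \<eta> N < \<infinity>"
  shows "positive_recurrent (states N) (network_generator \<gamma> \<xi> \<eta> \<beta> \<theta> \<epsilon> \<tau>)
       \<and> reversible (states N) (network_generator \<gamma> \<xi> \<eta> \<beta> \<theta> \<epsilon> \<tau>) (equilibrium \<gamma> \<xi> \<eta> N)
       \<and> (\<forall>\<mu>. stationary_distribution (states N) (network_generator \<gamma> \<xi> \<eta> \<beta> \<theta> \<epsilon> \<tau>) \<mu> \<longleftrightarrow>
                (\<forall>x\<in>states N. \<mu> x = equilibrium \<gamma> \<xi> \<eta> N x))"
proof -
  interpret network \<gamma> \<xi> \<eta> \<beta> \<theta> \<epsilon> \<tau> N
    by unfold_locales (fact assms)+
  show ?thesis
    using chain.positive_recurrent chain.reversible chain.stationary_iff by blast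
qed

end
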